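(* There exists an algorithm which, given a finite alphabet $X$ with at least two letters and a bounded automaton $A$ over $X$, decides whether the automaton group $G_A$ is finite.
   Context: A finite automaton over a finite alphabet $X$ ($|X|\ge 2$) is a tuple $A=(S,X,\pi)$ with $S$ a finite set of states and $\pi:S\times X\to X\times S$; write $s\xrightarrow{x|y}t$ when $\pi(s,x)=(y,t)$. Each state $s$ defines a length-preserving transformation of $X^*$: $s(x_1\ldots x_n)=y_1\ldots y_n$ if there is a path $s=s_1\xrightarrow{x_1|y_1}s_2\xrightarrow{x_2|y_2}\cdots\xrightarrow{x_n|y_n}s_{n+1}$; the final state $s_{n+1}$ is the section $s|_v$ of $s$ at $v=x_1\ldots x_n$. All automata are assumed minimal, i.e. different states define different transformations, and states are identified with the transformations they define; $e$ denotes the identity transformation (the trivial state). $A$ is invertible if every state defines an invertible transformation; then the automaton group $G_A$ is the group generated under composition by the transformations defined by the states of $A$. An invertible finite automaton $A$ is bounded if there is a constant $C$ such that $|\{v\in X^n : s|_v\neq e\}|\le C$ for all $n\in\mathbb{N}$ and all states $s$ of $A$. *)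

theory Defs
  imports "HOL-Library.Nat_Bijection" "HOL-Algebra.Bij"
    "HOL-Algebra.Generated_Groups"
begin

section \<open>Automata and their groups\<close>

record ('s, 'x) automaton =
  states :: "'s set"
  alphabet :: "'x set"
  step :: "'s \<Rightarrow> 'x \<Rightarrow> 'x \<times> 's"

definition finite_automaton :: "('s, 'x) automaton \<Rightarrow> bool" where
  "finite_automaton A \<longleftrightarrow>
     finite (states A) \<and> finite (alphabet A) \<and> card (alphabet A) \<ge> 2 \<and>
     (\<forall>s\<in>states A. \<forall>x\<in>alphabet A. step A s x \<in> alphabet A \<times> states A)"

fun action :: "('s, 'x) automaton \<Rightarrow> 's \<Rightarrow> 'x list \<Rightarrow> 'x list" where
  "action A s [] = []"
| "action A s (x # v) = fst (step A s x) # action A (snd (step A s x)) v"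

fun sect :: "('s, 'x) automaton \<Rightarrow> 's \<Rightarrow> 'x list \<Rightarrow> 's" where
  "sect A s [] = s"
| "sect A s (x # v) = sect A (snd (step A s x)) v"

text \<open>Words over \<open>X\<close> are the elements of \<open>lists X\<close>. Transformations of this set are
  extensional functions, as in \<^const>\<open>BijGroup\<close>; values outside it carry no information.\<close>

definition transformation :: "('s, 'x) automaton \<Rightarrow> 's \<Rightarrow> 'x list \<Rightarrow> 'x list" where
  "transformation A s = restrict (action A s) (lists (alphabet A))"

definition minimal_automaton :: "('s, 'x) automaton \<Rightarrow> bool" where
  "minimal_automaton A \<longleftrightarrow> inj_on (transformation A) (states A)"

definition invertible_automaton :: "('s, 'x) automaton \<Rightarrow> bool" where
  "invertible_automaton A \<longleftrightarrow>
     (\<forall>s\<in>states A. transformation A s \<in> Bij (lists (alphabet A)))"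

text \<open>As states are identified with the transformations they define, the trivial state is the
  one acting as the identity. It need not occur among the states.\<close>

definition trivial_state :: "('s, 'x) automaton \<Rightarrow> 's \<Rightarrow> bool" where
  "trivial_state A s \<longleftrightarrow> transformation A s = restrict id (lists (alphabet A))"

definition bounded_automaton :: "('s, 'x) automaton \<Rightarrow> bool" where
  "bounded_automaton A \<longleftrightarrow>
     finite_automaton A \<and> minimal_automaton A \<and> invertible_automaton A \<and>
     (\<exists>C::nat. \<forall>n. \<forall>s\<in>states A.
        card {v \<in> lists (alphabet A). length v = n \<and> \<not> trivial_state A (sect A s v)} \<le> C)"

definition automaton_group :: "('s, 'x) automaton \<Rightarrow> ('x list \<Rightarrow> 'x list) monoid" where
  "automaton_group A =
     (BijGroup (lists (alphabet A)))
       \<lparr>carrier := generate (BijGroup (lists (alphabet A))) (transformation A ` states A)\<rparr>"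


section \<open>Partial recursive functions\<close>

text \<open>An algorithm is a term denoting a partial recursive (\<open>\<mu>\<close>-recursive) function. Terms are
  not annotated with arities: \<open>recf_eval p xs y\<close> states that \<open>p\<close> terminates on the
  argument tuple \<open>xs\<close> with value \<open>y\<close>, and for each fixed length of \<open>xs\<close> it is the graph of
  a partial recursive function of that arity.\<close>

datatype recf =
    Zero
  | Succ
  | Proj nat
  | Comp recf "recf list"
  | PrimRec recf recf
  | Mu recf

inductive recf_eval :: "recf \<Rightarrow> nat list \<Rightarrow> nat \<Rightarrow> bool" where
  eval_Zero: "recf_eval Zero xs 0"
| eval_Succ: "recf_eval Succ [x] (Suc x)"
| eval_Proj: "i < length xs \<Longrightarrow> recf_eval (Proj i) xs (xs ! i)"
| eval_Comp: "list_all2 (\<lambda>g y. recf_eval g xs y) gs ys \<Longrightarrow> recf_eval f ys z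
    \<Longrightarrow> recf_eval (Comp f gs) xs z"
| eval_PrimRec_0: "recf_eval f xs y \<Longrightarrow> recf_eval (PrimRec f g) (0 # xs) y"
| eval_PrimRec_Suc: "recf_eval (PrimRec f g) (n # xs) y \<Longrightarrow> recf_eval g (n # y # xs) z
    \<Longrightarrow> recf_eval (PrimRec f g) (Suc n # xs) z"
| eval_Mu: "recf_eval f (n # xs) 0 \<Longrightarrow> (\<And>m. m < n \<Longrightarrow> \<exists>k. recf_eval f (m # xs) (Suc k))
    \<Longrightarrow> recf_eval (Mu f) xs n"

lemma recf_eval_deterministic:
  "recf_eval p xs y \<Longrightarrow> recf_eval p xs z \<Longrightarrow> y = z"
proof (induction arbitrary: z rule: recf_eval.induct)
  case (eval_Zero xs)
  then show ?case by cases simp_all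
next
  case (eval_Succ x)
  then show ?case by cases simp_all
next
  case (eval_Proj i xs)
  from eval_Proj.prems show ?case by cases simp_all
next
  case (eval_Comp xs gs ys f w)
  from eval_Comp.prems show ?case
  proof cases
    case comp: (eval_Comp ys')
    have "ys = ys'"
      using eval_Comp.IH(1) comp(1)
      by (auto simp: list_all2_conv_all_nth intro!: nth_equalityI)
    then show ?thesis using eval_Comp.IH(2) comp(2) by blast
  qed
next
  case (eval_PrimRec_0 f xs y g)
  from eval_PrimRec_0.prems show ?case
    by cases (rule eval_PrimRec_0.IH)
next
  case (eval_PrimRec_Suc f g n xs y w)
  from eval_PrimRec_Suc.prems show ?case
    by cases (use eval_PrimRec_Suc.IH in blast)
next
  case (eval_Mu f n xs)
  from eval_Mu.prems have z: "recf_eval f (z # xs) 0"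
    "\<And>m. m < z \<Longrightarrow> \<exists>k. recf_eval f (m # xs) (Suc k)"
    by (cases, blast)+
  show ?case
  proof (rule linorder_cases[of n z])
    assume "n < z"
    then obtain k where "recf_eval f (n # xs) (Suc k)" using z(2) by blast
    then have "0 = Suc k" by (rule eval_Mu.IH(1))
    then show ?thesis by simp
  next
    assume "z < n"
    then obtain k where "\<And>w. recf_eval f (z # xs) w \<Longrightarrow> Suc k = w" using eval_Mu.IH(2) by blast
    then have "Suc k = 0" using z(1) by blast
    then show ?thesis by simp
  qed
qed


section \<open>Automata as input of an algorithm\<close>

text \<open>To serve as input, letters and states are named by natural numbers. The input tuple
  consists of the alphabet, the set of states and the transitions
  \<open>s \<rightarrow> t\<close> with label \<open>x|y\<close>, where \<open>\<pi>(s, x) = (y, t)\<close>, each finite set being listed in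
  increasing order and coded by the bijections of \<open>Nat_Bijection\<close>.\<close>

definition automaton_input :: "(nat, nat) automaton \<Rightarrow> nat list" where
  "automaton_input A =
     (let xs = sorted_list_of_set (alphabet A); ss = sorted_list_of_set (states A) in
       [list_encode xs,
        list_encode ss,
        list_encode [prod_encode (prod_encode (s, x), prod_encode (step A s x)).
                       s \<leftarrow> ss, x \<leftarrow> xs]])"

end

theory Submission
  imports Defs
begin

text \<open>
  For a bounded automaton the number of words of length \<open>n\<close> with nontrivial section at a
  state is at most \<open>d ^ (2 * m + 1)\<close>, where \<open>d\<close> is the number of letters and \<open>m\<close> that of
  states: otherwise some nontrivial cycle could be left towards arbitrarily long live words,
  which contradicts boundedness. Call \<open>v\<close> and \<open>s(v)\<close> tied if the section \<open>s|_v\<close> is trivial,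
  and let a piece be a class of the equivalence relation generated by this. Appending a
  letter sends pieces into pieces, and pieces on level \<open>n\<close> are joined on level \<open>n + 1\<close> only
  along the boundedly many pairs \<open>v, s(v)\<close> with nontrivial section. Hence the way in which
  pieces are joined is governed by a configuration (sections at these pairs, and which of
  their ends lie in a common piece) that takes a computable number of values and determines
  its successor.

  If some piece is larger than an explicit bound, then along the chain of its ancestors some
  configuration with a marked piece recurs after the piece has strictly grown, so that this
  growth repeats forever. Conversely, if the pieces on sufficiently many levels have size at
  most \<open>Q\<close>, then a configuration recurs together with all sizes, and the bound persists on
  all levels. Orbits consist of boundedly many pieces, and the group is finite if and only
  if its orbits on words are bounded. Altogether the group is finite if and only if on all
  words of length at most a computable \<open>N\<close> every product of \<open>B + 1\<close> states acts like a
  product of at most \<open>B\<close> states, for a computable \<open>B\<close>; this is a primitive recursive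
  condition.
\<close>

section \<open>Recursive functions on coded data\<close>

text \<open>Codings are bijective, so \<open>dec\<close> is total and \<open>enc\<close> and
  \<open>dec\<close> cost no computation: on codes both are the identity.\<close>

class coded =
  fixes enc :: "'a \<Rightarrow> nat" and dec :: "nat \<Rightarrow> 'a"
  assumes dec_enc [simp]: "dec (enc x) = x" and enc_dec [simp]: "enc (dec n) = n"

instantiation nat :: coded
begin
definition enc_nat :: "nat \<Rightarrow> nat" where [simp]: "enc_nat n = n"
definition dec_nat :: "nat \<Rightarrow> nat" where [simp]: "dec_nat n = n"
instance by standard simp_all
end

instantiation prod :: (coded, coded) coded
begin
definition enc_prod :: "'a \<times> 'b \<Rightarrow> nat" where
  "enc_prod p = prod_encode (enc (fst p), enc (snd p))"
definition dec_prod :: "nat \<Rightarrow> 'a \<times> 'b" where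
  "dec_prod n = (dec (fst (prod_decode n)), dec (snd (prod_decode n)))"
instance by standard (simp_all add: enc_prod_def dec_prod_def)
end

instantiation list :: (coded) coded
begin
definition enc_list :: "'a list \<Rightarrow> nat" where
  "enc_list xs = list_encode (map enc xs)"
definition dec_list :: "nat \<Rightarrow> 'a list" where
  "dec_list n = map dec (list_decode n)"
instance by standard (simp_all add: enc_list_def dec_list_def comp_def)
end

text \<open>Terms carry no arity, so correctness is demanded on tuples of length \<open>k\<close>
  only.\<close>

definition computable :: "nat \<Rightarrow> (nat list \<Rightarrow> 'a::coded) \<Rightarrow> bool" where
  "computable k f \<longleftrightarrow> (\<exists>p. \<forall>xs. length xs = k \<longrightarrow> recf_eval p xs (enc (f xs)))"

section \<open>Closure properties of computable functions\<close>

lemma computable_cong: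
  "computable k f \<Longrightarrow> (\<And>xs. length xs = k \<Longrightarrow> f xs = g xs) \<Longrightarrow> computable k g"
  unfolding computable_def by metis

lemma computable_enc: "computable k f \<Longrightarrow> computable k (\<lambda>e. enc (f e))"
  by (simp add: computable_def)

lemma computable_encD: "computable k (\<lambda>e. enc (f e)) \<Longrightarrow> computable k f"
  by (simp add: computable_def)

lemma computable_dec: "computable k f \<Longrightarrow> computable k (\<lambda>e. dec (f e))"
  by (simp add: computable_def)

lemma computable_comp:
  assumes f: "computable (length gs) f" and gs: "\<forall>g\<in>set gs. computable k g"
  shows "computable k (\<lambda>xs. f (map (\<lambda>g. g xs) gs))"
proof -
  obtain p where p: "\<And>xs. length xs = length gs \<Longrightarrow> recf_eval p xs (enc (f xs))"
    using f unfolding computable_def by blast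
  obtain q where q: "\<And>g xs. g \<in> set gs \<Longrightarrow> length xs = k \<Longrightarrow> recf_eval (q g) xs (g xs)"
    using gs unfolding computable_def enc_nat_def by metis
  have "recf_eval (Comp p (map q gs)) xs (enc (f (map (\<lambda>g. g xs) gs)))" if "length xs = k" for xs
    by (rule eval_Comp[where ys = "map (\<lambda>g. g xs) gs"])
      (use p q that in \<open>auto simp: list_all2_conv_all_nth\<close>)
  then show ?thesis unfolding computable_def by blast
qed

lemma computable_comp1:
  "computable 1 (\<lambda>xs. f (xs ! 0)) \<Longrightarrow> computable k g \<Longrightarrow> computable k (\<lambda>xs. f (g xs))"
  using computable_comp[of "[g]" "\<lambda>xs. f (xs ! 0)" k] by simp

lemma computable_nth: "i < k \<Longrightarrow> computable k (\<lambda>xs. xs ! i)"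
  unfolding computable_def enc_nat_def using eval_Proj by metis

lemma computable_Suc: "computable k g \<Longrightarrow> computable k (\<lambda>xs. Suc (g xs))"
proof (rule computable_comp1[where f = Suc])
  have "recf_eval Succ xs (Suc (xs ! 0))" if "length xs = 1" for xs
    using that eval_Succ by (cases xs) auto
  then show "computable 1 (\<lambda>xs. Suc (xs ! 0))"
    unfolding computable_def enc_nat_def by blast
qed

lemma computable_const: "computable k (\<lambda>_. c)"
proof (rule computable_encD)
  have "computable k (\<lambda>_. n)" for n :: nat
  proof (induction n)
    case 0
    then show ?case unfolding computable_def using eval_Zero by fastforce
  qed (rule computable_Suc)
  then show "computable k (\<lambda>_. enc c)" .
qed

text \<open>Weakening of the context by composition with projections: bodies of recursions and folds
  see two extra arguments in front of the original tuple.\<close>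

lemma computable_tl: "computable k f \<Longrightarrow> computable (Suc k) (\<lambda>xs. f (tl xs))"
proof (rule computable_cong)
  let ?gs = "map (\<lambda>i xs. xs ! Suc i) [0..<k]"
  assume "computable k f"
  then show "computable (Suc k) (\<lambda>xs. f (map (\<lambda>g. g xs) ?gs))"
    by (intro computable_comp) (auto intro!: computable_nth)
  show "f (map (\<lambda>g. g xs) ?gs) = f (tl xs)" if "length xs = Suc k" for xs
    using that by (intro arg_cong[where f = f] nth_equalityI) (auto simp: nth_tl)
qed

lemma computable_tl2: "computable k f \<Longrightarrow> computable (Suc (Suc k)) (\<lambda>xs. f (tl (tl xs)))"
  using computable_tl[OF computable_tl, of k f] by simp

text \<open>The body of a recursion is a function of the argument tuple preceded by the counter (or, for
  \<open>foldl\<close>, the accumulator) and the previous value (or the current element).\<close>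

lemma computable_rec_nat_nat:
  fixes b :: "nat list \<Rightarrow> nat"
  assumes b: "computable k b" and n: "computable k n"
    and g: "computable (Suc (Suc k)) (\<lambda>ys. g (ys ! 0) (ys ! 1) (tl (tl ys)))"
  shows "computable k (\<lambda>e. rec_nat (b e) (\<lambda>i r. g i r e) (n e))"
proof -
  obtain pb where pb: "\<And>xs. length xs = k \<Longrightarrow> recf_eval pb xs (b xs)"
    using b unfolding computable_def enc_nat_def by blast
  obtain pg where pg: "\<And>ys. length ys = Suc (Suc k)
      \<Longrightarrow> recf_eval pg ys (g (ys ! 0) (ys ! 1) (tl (tl ys)))"
    using g unfolding computable_def enc_nat_def by blast
  have ev: "recf_eval (PrimRec pb pg) (m # xs) (rec_nat (b xs) (\<lambda>i r. g i r xs) m)"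
    if "length xs = k" for m xs
  proof (induction m)
    case 0
    then show ?case using pb that by (simp add: eval_PrimRec_0)
  next
    case (Suc m)
    then show ?case
      using eval_PrimRec_Suc[OF Suc] pg[of "m # rec_nat (b xs) (\<lambda>i r. g i r xs) m # xs"] that
      by simp
  qed
  let ?gs = "n # map (\<lambda>i xs. xs ! i) [0..<k]"
  let ?f = "\<lambda>ys. rec_nat (b (tl ys)) (\<lambda>i r. g i r (tl ys)) (ys ! 0)"
  have "computable (Suc k) ?f"
    unfolding computable_def enc_nat_def
    by (rule exI[of _ "PrimRec pb pg"]) (use ev in \<open>auto simp: length_Suc_conv\<close>)
  then have "computable k (\<lambda>xs. ?f (map (\<lambda>g. g xs) ?gs))"
    by (intro computable_comp) (auto intro: computable_nth n)
  then show ?thesis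
  proof (rule computable_cong)
    fix xs :: "nat list" assume "length xs = k"
    then have "map (\<lambda>g. g xs) (map (\<lambda>i xs. xs ! i) [0..<k]) = xs"
      by (intro nth_equalityI) auto
    then show "?f (map (\<lambda>g. g xs) ?gs) = rec_nat (b xs) (\<lambda>i r. g i r xs) (n xs)"
      by simp
  qed
qed

lemma computable_rec_nat:
  fixes b :: "nat list \<Rightarrow> 'a::coded"
  assumes b: "computable k b" and n: "computable k n"
    and g: "computable (Suc (Suc k)) (\<lambda>ys. g (ys ! 0) (dec (ys ! 1)) (tl (tl ys)))"
  shows "computable k (\<lambda>e. rec_nat (b e) (\<lambda>i r. g i r e) (n e))"
proof (rule computable_encD)
  have eq: "enc (rec_nat a (\<lambda>i r. g i r e) m) =
      rec_nat (enc a) (\<lambda>i r. enc (g i (dec r) e)) m" for a e m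
    by (induction m) (simp_all, metis dec_enc)
  show "computable k (\<lambda>e. enc (rec_nat (b e) (\<lambda>i r. g i r e) (n e)))"
    unfolding eq by (intro computable_rec_nat_nat[OF _ n] computable_enc b g)
qed

lemma computable_add: "computable k f \<Longrightarrow> computable k g \<Longrightarrow> computable k (\<lambda>e. f e + g e :: nat)"
proof -
  have "a + b = rec_nat a (\<lambda>_ r. Suc r) b" for a b :: nat by (induction b) simp_all
  then show "computable k f \<Longrightarrow> computable k g \<Longrightarrow> ?thesis"
    by (simp add: computable_rec_nat_nat computable_Suc computable_nth)
qed

lemma computable_mult: "computable k f \<Longrightarrow> computable k g \<Longrightarrow> computable k (\<lambda>e. f e * g e :: nat)"
proof -
  assume f: "computable k f" and g: "computable k g"
  have "a * b = rec_nat 0 (\<lambda>_ r. r + a) b" for a b :: nat by (induction b) simp_all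
  then show ?thesis
    by (simp add: computable_rec_nat_nat computable_add computable_nth computable_const
        computable_tl2 f g)
qed

lemma computable_power: "computable k f \<Longrightarrow> computable k g \<Longrightarrow> computable k (\<lambda>e. f e ^ g e :: nat)"
proof -
  assume f: "computable k f" and g: "computable k g"
  have "a ^ b = rec_nat 1 (\<lambda>_ r. r * a) b" for a b :: nat by (induction b) simp_all
  then show ?thesis
    by (simp add: computable_rec_nat_nat computable_mult computable_nth computable_const
        computable_tl2 f g)
qed

lemma computable_diff: "computable k f \<Longrightarrow> computable k g \<Longrightarrow> computable k (\<lambda>e. f e - g e :: nat)"
proof -
  assume f: "computable k f" and g: "computable k g"
  have pred: "computable j h \<Longrightarrow> computable j (\<lambda>e. h e - 1)" for j and h :: "nat list \<Rightarrow> nat"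
  proof -
    have "a - 1 = rec_nat 0 (\<lambda>i _. i) a" for a :: nat by (cases a) simp_all
    then show "computable j h \<Longrightarrow> ?thesis"
      by (simp add: computable_rec_nat_nat computable_nth computable_const)
  qed
  have "computable k (\<lambda>e. rec_nat (f e) (\<lambda>_ r. r - 1) (g e))"
    by (intro computable_rec_nat_nat f g pred computable_nth) simp
  moreover have "rec_nat a (\<lambda>_ r. r - 1) b = a - b" for a b :: nat by (induction b) simp_all
  ultimately show ?thesis by (simp add: computable_cong)
qed

definition computable_pred :: "nat \<Rightarrow> (nat list \<Rightarrow> bool) \<Rightarrow> bool" where
  "computable_pred k P \<longleftrightarrow> computable k (\<lambda>e. if P e then 1 else 0 :: nat)"

text \<open>A case distinction is a primitive recursion whose number of rounds is the indicator of
  \<open>P\<close>.\<close>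

lemma computable_if:
  assumes P: "computable_pred k P" and f: "computable k f" and g: "computable k g"
  shows "computable k (\<lambda>e. if P e then f e else g e)"
proof -
  have "(if P e then f e else g e) =
      rec_nat (g e) (\<lambda>_ _. f e) (if P e then 1 else 0)" for e by simp
  then show ?thesis
    using computable_rec_nat[OF g P[unfolded computable_pred_def] computable_tl2[OF f]] by simp
qed

lemma computable_pred_le:
  assumes f: "computable k f" and g: "computable k g"
  shows "computable_pred k (\<lambda>e. f e \<le> (g e :: nat))"
proof -
  have "(if a \<le> b then 1 else 0) = 1 - (a - b)" for a b :: nat by simp
  then show ?thesis
    by (simp only: computable_pred_def) (intro computable_diff computable_const f g)
qed

lemma computable_pred_conj:
  assumes f: "computable_pred k P" and g: "computable_pred k Q"
  shows "computable_pred k (\<lambda>e. P e \<and> Q e)"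
proof -
  have "(if P e \<and> Q e then 1 else 0) = (if P e then if Q e then 1 else 0 else 0 :: nat)" for e
    by simp
  then show ?thesis using f g
    by (simp only: computable_pred_def)
      (intro computable_if computable_const, simp_all add: computable_pred_def)
qed

lemma computable_pred_eq:
  fixes f :: "nat list \<Rightarrow> 'a::coded"
  assumes f: "computable k f" and g: "computable k g"
  shows "computable_pred k (\<lambda>e. f e = g e)"
proof -
  have "f e = g e \<longleftrightarrow> enc (f e) \<le> enc (g e) \<and> enc (g e) \<le> enc (f e)" for e
    by (metis dec_enc order_antisym order_refl)
  then show ?thesis
    by (simp add: computable_pred_conj computable_pred_le computable_enc f g)
qed

section \<open>The Cantor pairing\<close>

lemma computable_triangle: "computable k f \<Longrightarrow> computable k (\<lambda>e. triangle (f e))"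
proof -
  have "triangle n = rec_nat 0 (\<lambda>i r. r + Suc i) n" for n by (induction n) simp_all
  then show "computable k f \<Longrightarrow> ?thesis"
    by (simp add: computable_rec_nat_nat computable_add computable_Suc computable_nth
        computable_const del: add_Suc_right)
qed

lemma computable_prod_encode:
  "computable k f \<Longrightarrow> computable k g \<Longrightarrow> computable k (\<lambda>e. prod_encode (f e, g e))"
  by (simp add: prod_encode_def computable_add computable_triangle)

text \<open>The diagonal on which the code \<open>n\<close> lies, that is the sum of the two
  components of \<open>prod_decode n\<close>, found by primitive recursion.\<close>

definition triangle_root :: "nat \<Rightarrow> nat" where
  "triangle_root n = rec_nat 0 (\<lambda>i r. if triangle (Suc r) \<le> Suc i then Suc r else r) n"

lemma triangle_root:
  "triangle (triangle_root n) \<le> n \<and> n < triangle (Suc (triangle_root n))"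
  by (induction n) (auto simp: triangle_root_def)

lemma prod_decode_triangle_root:
  "prod_decode n = (n - triangle (triangle_root n), triangle_root n - (n - triangle (triangle_root n)))"
proof -
  let ?r = "triangle_root n"
  have "prod_encode (n - triangle ?r, ?r - (n - triangle ?r)) = n"
    using triangle_root[of n] by (simp add: prod_encode_def)
  then show ?thesis by (metis prod_encode_inverse)
qed

lemma computable_triangle_root: "computable k f \<Longrightarrow> computable k (\<lambda>e. triangle_root (f e))"
  unfolding triangle_root_def
  by (intro computable_rec_nat_nat computable_if computable_pred_le computable_triangle
      computable_Suc computable_nth computable_const) simp_all

lemma computable_prod_decode:
  assumes f: "computable k f"
  shows "computable k (\<lambda>e. fst (prod_decode (f e)))" "computable k (\<lambda>e. snd (prod_decode (f e)))"
  by (simp_all only: prod_decode_triangle_root fst_conv snd_conv)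
    (intro computable_diff computable_triangle computable_triangle_root f)+

lemma computable_fst: "computable k p \<Longrightarrow> computable k (\<lambda>e. fst (p e))"
  and computable_snd: "computable k p \<Longrightarrow> computable k (\<lambda>e. snd (p e))"
  and computable_Pair: "computable k f \<Longrightarrow> computable k g \<Longrightarrow> computable k (\<lambda>e. (f e, g e))"
proof -
  assume "computable k p"
  then have p: "computable k (\<lambda>e. enc (p e))" by (rule computable_enc)
  show "computable k (\<lambda>e. fst (p e))" "computable k (\<lambda>e. snd (p e))"
    by (rule computable_encD, use computable_prod_decode[OF p] in \<open>simp add: enc_prod_def\<close>)+
next
  assume "computable k f" "computable k g"
  then show "computable k (\<lambda>e. (f e, g e))"
    by - (rule computable_encD, simp add: enc_prod_def computable_prod_encode computable_enc)
qed

section \<open>Lists and folds on codes\<close>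

lemma computable_Cons: "computable k f \<Longrightarrow> computable k g \<Longrightarrow> computable k (\<lambda>e. f e # g e)"
proof (rule computable_encD)
  have "enc (x # xs) = Suc (prod_encode (enc x, enc xs))" for x :: 'a and xs
    by (simp add: enc_list_def)
  then show "computable k f \<Longrightarrow> computable k g \<Longrightarrow> computable k (\<lambda>e. enc (f e # g e))"
    by (simp add: computable_Suc computable_prod_encode computable_enc)
qed

text \<open>Only the values of \<open>hd\<close> and \<open>tl\<close> at nonempty lists are needed, so the computable
  functions below may differ from them at the empty list.\<close>

definition head :: "'a::coded list \<Rightarrow> 'a" where
  "head xs = dec (fst (prod_decode (enc xs - 1)))"

definition tail :: "'a::coded list \<Rightarrow> 'a list" where
  "tail xs = dec (snd (prod_decode (enc xs - 1)))"

lemma head_Cons [simp]: "head (x # xs) = x" and tail_Cons [simp]: "tail (x # xs) = xs"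
  by (simp_all add: head_def tail_def enc_list_def dec_list_def comp_def)

lemma computable_head: "computable k f \<Longrightarrow> computable k (\<lambda>e. head (f e))"
  and computable_tail: "computable k f \<Longrightarrow> computable k (\<lambda>e. tail (f e))"
  unfolding head_def tail_def
  by (intro computable_dec computable_prod_decode computable_diff computable_const computable_enc;
      assumption)+

lemma length_le_enc: "length xs \<le> enc xs"
proof (induction xs)
  case (Cons x xs)
  then show ?case
    using le_prod_encode_2[of "enc xs" "enc x"] by (simp add: enc_list_def)
qed simp

text \<open>The recursion carries the accumulator and the remaining list and idles once the list is
  empty. Any \<open>n\<close> from the length on therefore serves; later it is the code of the
  list.\<close>

lemma foldl_eq_rec_nat:
  assumes "length xs \<le> n"
  shows "foldl f a xs = fst (rec_nat (a, xs)
    (\<lambda>_ p. if snd p = [] then p else (f (fst p) (head (snd p)), tail (snd p))) n)"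
    (is "_ = fst (?r n)")
proof -
  have *: "foldl f (fst (?r m)) (snd (?r m)) = foldl f a xs \<and> length (snd (?r m)) = length xs - m"
    for m
  proof (induction m)
    case (Suc m)
    then show ?case by (cases "snd (?r m)") auto
  qed simp
  from *[of n] assms have "snd (?r n) = []" by simp
  with *[of n] show ?thesis by (metis foldl_Nil)
qed

lemma computable_foldl:
  fixes a :: "nat list \<Rightarrow> 'a::coded" and xs :: "nat list \<Rightarrow> 'b::coded list"
  assumes a: "computable k a" and xs: "computable k xs"
    and f: "computable (Suc (Suc k)) (\<lambda>ys. f (dec (ys ! 0)) (dec (ys ! 1)) (tl (tl ys)))"
  shows "computable k (\<lambda>e. foldl (\<lambda>r x. f r x e) (a e) (xs e))"
proof -
  let ?p = "\<lambda>ys :: nat list. dec (ys ! 1) :: 'a \<times> 'b list"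
  have p: "computable (Suc (Suc k)) ?p" by (intro computable_dec computable_nth) simp
  \<comment> \<open>The recursion supplies counter, coded pair and context, whereas \<open>f\<close>
    expects accumulator, element and context; these projections rearrange the arguments.\<close>
  let ?gs = "(\<lambda>ys. enc (fst (?p ys))) # (\<lambda>ys. enc (head (snd (?p ys)))) #
      map (\<lambda>i ys. ys ! (i + 2)) [0..<k]"
  have "computable (Suc (Suc k)) (\<lambda>ys.
      (\<lambda>ys. f (dec (ys ! 0)) (dec (ys ! 1)) (tl (tl ys))) (map (\<lambda>g. g ys) ?gs))"
  proof (rule computable_comp)
    show "computable (length ?gs) (\<lambda>ys. f (dec (ys ! 0)) (dec (ys ! 1)) (tl (tl ys)))"
      using f by simp
    have "computable (Suc (Suc k)) (\<lambda>ys. enc (fst (?p ys)))"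
      "computable (Suc (Suc k)) (\<lambda>ys. enc (head (snd (?p ys))))"
      by (intro computable_enc computable_fst computable_head computable_snd p)+
    then show "\<forall>g\<in>set ?gs. computable (Suc (Suc k)) g"
      by (simp add: computable_nth del: One_nat_def)
  qed
  then have *: "computable (Suc (Suc k)) (\<lambda>ys. f (fst (?p ys)) (head (snd (?p ys))) (tl (tl ys)))"
  proof (rule computable_cong)
    fix ys :: "nat list" assume "length ys = Suc (Suc k)"
    then have "map (\<lambda>g. g ys) (map (\<lambda>i ys. ys ! (i + 2)) [0..<k]) = tl (tl ys)"
      by (intro nth_equalityI) (auto simp: nth_tl)
    then show "(\<lambda>ys. f (dec (ys ! 0)) (dec (ys ! 1)) (tl (tl ys))) (map (\<lambda>g. g ys) ?gs)
        = f (fst (?p ys)) (head (snd (?p ys))) (tl (tl ys))" by simp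
  qed
  show ?thesis
    unfolding foldl_eq_rec_nat[OF length_le_enc]
    by (intro computable_fst computable_rec_nat computable_Pair a xs computable_enc
        computable_if computable_pred_eq computable_snd p computable_const computable_tail *)
qed

lemma computable_pred_ball:
  fixes xs :: "nat list \<Rightarrow> 'b::coded list"
  assumes xs: "computable k xs"
    and P: "computable_pred (Suc (Suc k)) (\<lambda>ys. P (dec (ys ! 1)) (tl (tl ys)))"
  shows "computable_pred k (\<lambda>e. \<forall>x\<in>set (xs e). P x e)"
proof -
  have "(if \<forall>x\<in>set xs. Q x then 1 else 0 :: nat) = foldl (\<lambda>r x. if Q x then r else 0) 1 xs"
    for Q and xs :: "'b list"
    by (induction xs rule: rev_induct) auto
  then show ?thesis
    unfolding computable_pred_def
    by (simp only:) (intro computable_foldl computable_if P xs computable_const computable_dec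
        computable_nth, simp)
qed

lemma computable_pred_bex:
  fixes xs :: "nat list \<Rightarrow> 'b::coded list"
  assumes xs: "computable k xs"
    and P: "computable_pred (Suc (Suc k)) (\<lambda>ys. P (dec (ys ! 1)) (tl (tl ys)))"
  shows "computable_pred k (\<lambda>e. \<exists>x\<in>set (xs e). P x e)"
proof -
  have "(if \<exists>x\<in>set xs. Q x then 1 else 0 :: nat) = foldl (\<lambda>r x. if Q x then 1 else r) 0 xs"
    for Q and xs :: "'b list"
    by (induction xs rule: rev_induct) auto
  then show ?thesis
    unfolding computable_pred_def
    by (simp only:) (intro computable_foldl computable_if P xs computable_const computable_dec
        computable_nth, simp)
qed

section \<open>Simulating the automaton on codes\<close>

definition lookup :: "((nat \<times> nat) \<times> (nat \<times> nat)) list \<Rightarrow> nat \<times> nat \<Rightarrow> nat \<times> nat" where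
  "lookup tr q = foldl (\<lambda>r t. if fst t = q then snd t else r) (0, 0) tr"

text \<open>The inner fold tracks the current state and collects the output in reverse; the outer
  fold turns it around.\<close>

definition run :: "((nat \<times> nat) \<times> (nat \<times> nat)) list \<Rightarrow> nat \<Rightarrow> nat list \<Rightarrow> nat list" where
  "run tr s v = foldl (\<lambda>r x. x # r) [] (snd (foldl
     (\<lambda>p x. (snd (lookup tr (fst p, x)), fst (lookup tr (fst p, x)) # snd p)) (s, []) v))"

text \<open>Each round starts again from \<open>[[]]\<close>, so the words shorter than
  \<open>n\<close> are kept.\<close>

definition words :: "nat list \<Rightarrow> nat \<Rightarrow> nat list list" where
  "words xs n = rec_nat [[]]
     (\<lambda>_ ws. foldl (\<lambda>r v. foldl (\<lambda>r x. (x # v) # r) r xs) [[]] ws) n"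

lemma computable_lookup:
  assumes "computable k tr" "computable k q"
  shows "computable k (\<lambda>e. lookup (tr e) (q e))"
  unfolding lookup_def
  by (intro computable_foldl computable_if computable_pred_eq computable_fst computable_snd
      computable_dec computable_nth computable_const computable_tl2 assms) simp_all

lemma computable_run:
  assumes "computable k tr" "computable k s" "computable k v"
  shows "computable k (\<lambda>e. run (tr e) (s e) (v e))"
  unfolding run_def
  by (intro computable_foldl computable_Pair computable_fst computable_snd computable_Cons
      computable_lookup computable_dec computable_nth computable_const
      computable_tl2[OF assms(1)] assms) simp_all

lemma computable_words:
  assumes "computable k xs" "computable k n"
  shows "computable k (\<lambda>e. words (xs e) (n e))"
  unfolding words_def
  by (intro computable_rec_nat computable_foldl computable_Cons computable_dec computable_nth
      computable_const computable_tl2[OF computable_nth] computable_tl2[OF assms(1)]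
      computable_tl2[OF computable_tl2[OF assms(1)]] assms) simp_all

lemma computable_foldl_run:
  assumes "computable k tr" "computable k w" "computable k v"
  shows "computable k (\<lambda>e. foldl (\<lambda>v s. run (tr e) s v) (v e) (w e))"
  by (intro computable_foldl computable_run computable_dec computable_nth
      computable_tl2[OF assms(1)] assms) simp_all

lemma computable_pred_shortening:
  assumes tr: "computable k tr" and xs: "computable k xs" and ss: "computable k ss"
    and N: "computable k N" and B: "computable k B"
  shows "computable_pred k (\<lambda>e. \<forall>v\<in>set (words (xs e) (N e)). \<forall>w\<in>set (words (ss e) (Suc (B e))).
    \<exists>w'\<in>set (words (ss e) (B e)).
      foldl (\<lambda>v s. run (tr e) s v) v w = foldl (\<lambda>v s. run (tr e) s v) v w')"
  \<comment> \<open>Every quantifier puts two arguments in front of the tuple, hence the nested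
    instances of \<open>computable_tl2\<close>.\<close>
  by (intro computable_pred_ball computable_pred_bex computable_pred_eq
      computable_foldl_run computable_words computable_Suc
      computable_tl2[OF computable_tl2[OF computable_tl2[OF tr]]]
      computable_tl2[OF ss] computable_tl2[OF B] computable_tl2[OF computable_tl2[OF ss]]
      computable_tl2[OF computable_tl2[OF B]] computable_dec computable_nth
      computable_tl2[OF computable_nth] computable_tl2[OF computable_dec[OF computable_nth]]
      computable_tl2[OF computable_tl2[OF computable_dec[OF computable_nth]]] xs N) simp_all

lemma set_words: "set (words xs n) = {v \<in> lists (set xs). length v \<le> n}"
proof (induction n)
  case 0
  then show ?case by (auto simp: words_def)
next
  case (Suc n)
  have inner: "set (foldl (\<lambda>r x. (x # v) # r) r xs) = (\<lambda>x. x # v) ` set xs \<union> set r" for r v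
    by (induction xs arbitrary: r) auto
  have "set (foldl (\<lambda>r v. foldl (\<lambda>r x. (x # v) # r) r xs) r ws) =
      {x # v | x v. x \<in> set xs \<and> v \<in> set ws} \<union> set r" for r ws
    by (induction ws arbitrary: r) (auto simp: inner)
  then have "set (words xs (Suc n)) = {x # v | x v. x \<in> set xs \<and> v \<in> set (words xs n)} \<union> {[]}"
    by (simp add: words_def)
  also have "\<dots> = {v \<in> lists (set xs). length v \<le> Suc n}"
  proof (rule Set.set_eqI)
    show "v \<in> {x # v | x v. x \<in> set xs \<and> v \<in> set (words xs n)} \<union> {[]} \<longleftrightarrow>
        v \<in> {v \<in> lists (set xs). length v \<le> Suc n}" for v
      by (cases v) (auto simp: Suc.IH)
  qed
  finally show ?case .
qed

lemma lookup_map: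
  assumes "(q, r) \<in> set tr" "\<And>r'. (q, r') \<in> set tr \<Longrightarrow> r' = r"
  shows "lookup tr q = r"
  using assms unfolding lookup_def
  by (induction tr rule: rev_induct) (force split: if_splits)+

lemma run_eq_action:
  assumes "\<And>s x. s \<in> states A \<Longrightarrow> x \<in> alphabet A \<Longrightarrow> lookup tr (s, x) = step A s x"
    and "finite_automaton A" and s: "s \<in> states A" and v: "v \<in> lists (alphabet A)"
  shows "run tr s v = action A s v"
proof -
  have rev: "foldl (\<lambda>r x. x # r) ys v = rev v @ ys" for ys v :: "nat list"
    by (induction v arbitrary: ys) auto
  have "snd (foldl (\<lambda>p x. (snd (lookup tr (fst p, x)), fst (lookup tr (fst p, x)) # snd p))
      (s, ys) v) = rev (action A s v) @ ys" for ys
    using v s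
  proof (induction v arbitrary: s ys rule: lists.induct)
    case (Cons x v)
    then have "snd (step A s x) \<in> states A"
      using assms(2) by (auto simp: finite_automaton_def mem_Times_iff)
    with Cons show ?case by (simp add: assms(1))
  qed simp
  then show ?thesis by (simp add: run_def rev)
qed

section \<open>Words with nontrivial section\<close>

lemma action_append: "action A s (u @ v) = action A s u @ action A (sect A s u) v"
  by (induction u arbitrary: s) auto

lemma sect_append: "sect A s (u @ v) = sect A (sect A s u) v"
  by (induction u arbitrary: s) auto

lemma length_action [simp]: "length (action A s v) = length v"
  by (induction v arbitrary: s) auto

lemma sect_power: "sect A s w = s \<Longrightarrow> sect A s (concat (replicate k w)) = s"
  by (induction k) (auto simp: sect_append)

lemma length_concat_replicate [simp]: "length (concat (replicate k w)) = k * length w"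
  by (induction k) auto

locale bounded_aut =
  fixes A :: "('s, 'x) automaton"
  assumes bounded: "bounded_automaton A"
begin

abbreviation S where "S \<equiv> states A"
abbreviation X where "X \<equiv> alphabet A"
abbreviation act where "act \<equiv> action A"
abbreviation sec where "sec \<equiv> sect A"
abbreviation triv where "triv \<equiv> trivial_state A"

definition d :: nat where "d = card X"
definition m :: nat where "m = card S"

lemma automaton_simps: "finite_automaton A" "minimal_automaton A" "invertible_automaton A"
  using bounded by (auto simp: bounded_automaton_def)

lemma finite_S [simp]: "finite S" and finite_X [simp]: "finite X" and d_ge_2: "d \<ge> 2"
  using automaton_simps(1) by (auto simp: finite_automaton_def d_def)

lemma step_in: "s \<in> S \<Longrightarrow> x \<in> X \<Longrightarrow> fst (step A s x) \<in> X"
    "s \<in> S \<Longrightarrow> x \<in> X \<Longrightarrow> snd (step A s x) \<in> S"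
  using automaton_simps(1) by (auto simp: finite_automaton_def mem_Times_iff)

lemma sec_in: "v \<in> lists X \<Longrightarrow> s \<in> S \<Longrightarrow> sec s v \<in> S"
  by (induction v arbitrary: s rule: lists.induct) (auto simp: step_in)

lemma act_in: "v \<in> lists X \<Longrightarrow> s \<in> S \<Longrightarrow> act s v \<in> lists X"
  by (induction v arbitrary: s rule: lists.induct) (auto simp: step_in)

lemma triv_iff: "triv s \<longleftrightarrow> (\<forall>v\<in>lists X. act s v = v)"
  unfolding trivial_state_def transformation_def restrict_def fun_eq_iff by auto

lemma triv_sec: "triv s \<Longrightarrow> v \<in> lists X \<Longrightarrow> triv (sec s v)"
  unfolding triv_iff by (metis append_in_lists_conv action_append same_append_eq)

lemma bij_act: "s \<in> S \<Longrightarrow> bij_betw (act s) (lists X) (lists X)"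
  using automaton_simps(3) unfolding invertible_automaton_def Bij_def transformation_def
  by (auto simp: bij_betw_def inj_on_def)

lemma finite_length [simp]: "finite {v \<in> lists X. length v = n}"
  and card_length: "card {v \<in> lists X. length v = n} = d ^ n"
  using finite_lists_length_eq[OF finite_X, of n] card_lists_length_eq[OF finite_X, of n]
  by (simp_all add: lists_eq_set d_def)

section \<open>Live words and their number\<close>

definition live :: "'s \<Rightarrow> nat \<Rightarrow> 'x list set" where
  "live s n = {v \<in> lists X. length v = n \<and> \<not> triv (sec s v)}"

definition immortal :: "'s \<Rightarrow> bool" where
  "immortal s \<longleftrightarrow> (\<forall>n. live s n \<noteq> {})"

lemma finite_live [simp]: "finite (live s n)"
  by (rule finite_subset[OF _ finite_length[of n]]) (auto simp: live_def)

lemma live_bound: obtains C where "\<And>s n. s \<in> S \<Longrightarrow> card (live s n) \<le> C"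
  using bounded unfolding bounded_automaton_def live_def by blast

text \<open>A trivial section stays trivial under further letters, so prefixes of live words are
  live.\<close>

lemma live_take: "v \<in> live s n \<Longrightarrow> k \<le> n \<Longrightarrow> take k v \<in> live s k"
  unfolding live_def using triv_sec[of "sec s (take k v)" "drop k v"]
  by (auto simp: in_lists_conv_set dest: in_set_takeD in_set_dropD simp flip: sect_append)

text \<open>Pumping: among the \<open>m + 1\<close> sections at prefixes of length at most
  \<open>m\<close> two agree, and the factor between them is a loop at a nontrivial state that can
  be repeated at will.\<close>

lemma immortal_if_live_card:
  assumes s: "s \<in> S" and n: "n \<ge> m" and v: "v \<in> live s n"
  shows "immortal s"
proof -
  have vX: "v \<in> lists X" "length v = n" using v by (auto simp: live_def)
  have "\<not> inj_on (\<lambda>i. sec s (take i v)) {..m}"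
  proof
    assume "inj_on (\<lambda>i. sec s (take i v)) {..m}"
    moreover have "(\<lambda>i. sec s (take i v)) ` {..m} \<subseteq> S"
      using vX s by (auto intro!: sec_in simp: in_lists_conv_set dest: in_set_takeD)
    ultimately have "card {..m} \<le> card S" by (intro card_inj_on_le) auto
    then show False by (simp add: m_def)
  qed
  then obtain i j where ij: "i < j" "j \<le> m" "sec s (take i v) = sec s (take j v)"
    unfolding inj_on_def by (metis atMost_iff linorder_neqE_nat)
  define w where "w = drop i (take j v)"
  define t where "t = sec s (take i v)"
  have jv: "take j v = take i v @ w"
    using ij by (simp add: w_def) (metis append_take_drop_id min.absorb1 less_imp_le take_take)
  have loop: "sec t w = t" using ij(3) jv by (simp add: sect_append t_def)
  have nt: "\<not> triv t"
    using live_take[OF v, of i] ij n by (simp add: live_def t_def)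
  have wX: "w \<in> lists X" "take i v \<in> lists X" and wl: "length w \<ge> 1"
    using vX ij n by (auto simp: w_def in_lists_conv_set dest: in_set_takeD in_set_dropD)
  show ?thesis
    unfolding immortal_def
  proof
    fix k
    let ?u = "take i v @ concat (replicate k w)"
    have "?u \<in> live s (length ?u)"
      using nt wX by (auto simp: live_def sect_append sect_power loop t_def[symmetric])
    moreover have "k \<le> length ?u" using wl by (simp add: trans_le_add2)
    ultimately show "live s k \<noteq> {}" using live_take by blast
  qed
qed

text \<open>A cycle through \<open>t\<close> with an exit to a state having arbitrarily long live words
  produces \<open>K + 1\<close> live words of equal length for every \<open>K\<close>, according to how often
  the cycle is traversed before leaving it.\<close>

lemma no_exit_from_cycle:
  assumes t: "t \<in> S" and w: "w \<in> lists X" "w \<noteq> []" "sec t w = t"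
    and y: "y \<in> X" "y \<noteq> hd w" and imm: "immortal (sec t [y])"
  shows False
proof -
  obtain C where C: "\<And>s n. s \<in> S \<Longrightarrow> card (live s n) \<le> C" using live_bound by blast
  define z where "z n = (SOME z. z \<in> live (sec t [y]) n)" for n
  have z: "z n \<in> live (sec t [y]) n" for n
    using imm unfolding immortal_def z_def by (metis some_in_eq)
  define l where "l = length w"
  have l: "l > 0" using w by (simp add: l_def)
  \<comment> \<open>The tail is chosen so that all \<open>g i\<close> have length
    \<open>Suc C * l + 1\<close>. For \<open>i < j\<close> the words differ at position
    \<open>i * l\<close>, where \<open>g i\<close> leaves the cycle by \<open>y\<close> and
    \<open>g j\<close> continues with \<open>hd w\<close>.\<close>
  define g where "g i = concat (replicate i w) @ y # z ((Suc C - i) * l)" for i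
  have "g i \<in> live t (Suc C * l + 1)" if "i \<le> Suc C" for i
  proof -
    have "length (g i) = i * l + 1 + (Suc C - i) * l"
      using z[of "(Suc C - i) * l"] by (simp add: g_def live_def l_def)
    also have "\<dots> = Suc C * l + 1"
      using that by (metis add.assoc add.commute distrib_right le_add_diff_inverse)
    finally show ?thesis
      using z[of "(Suc C - i) * l"] w y
      by (auto simp: g_def live_def sect_append sect_power in_lists_conv_set)
  qed
  moreover have "inj_on g {..Suc C}"
  proof (rule linorder_inj_onI)
    fix i j :: nat assume ij: "i < j"
    then obtain k where k: "j = i + Suc k" by (metis add_Suc_right less_iff_Suc_add)
    have "g i ! (i * l) = y" by (simp add: g_def l_def nth_append)
    moreover have "g j = concat (replicate i w) @ w @ concat (replicate k w) @ y # z ((Suc C - j) * l)"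
      by (simp add: g_def k replicate_add del: add_Suc_right)
    then have "g j ! (i * l) = hd w" using w(2) by (simp add: l_def nth_append hd_conv_nth)
    ultimately show "g i \<noteq> g j" using y by metis
  qed auto
  ultimately have "card {..Suc C} \<le> card (live t (Suc C * l + 1))"
    by (intro card_inj_on_le) auto
  then show False using C[OF t, of "Suc C * l + 1"] by simp
qed

lemma card_live_Suc:
  "card (live s (Suc n)) \<le> (\<Sum>x\<in>X. card (live (sec s [x]) n))"
proof -
  have "live s (Suc n) = (\<Union>x\<in>X. (#) x ` live (sec s [x]) n)"
    by (auto simp: live_def length_Suc_conv image_iff)
  then have "card (live s (Suc n)) \<le> (\<Sum>x\<in>X. card ((#) x ` live (sec s [x]) n))"
    by (simp add: card_UN_le)
  then show ?thesis by (simp add: card_image)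
qed

text \<open>The set \<open>V\<close> collects the states passed at which a second branch survives. By
  \<open>no_exit_from_cycle\<close> no state can be collected twice.\<close>

lemma card_live_aux:
  assumes "s \<in> S" "V \<subseteq> S"
    and "\<And>t. t \<in> V \<Longrightarrow> \<exists>w y. w \<in> lists X \<and> w \<noteq> [] \<and> sec t w = s \<and> y \<in> X \<and> y \<noteq> hd w \<and>
      immortal (sec t [y])"
  shows "card (live s n) \<le> d ^ ((m - card V) + m + 1)"
  using assms
proof (induction n arbitrary: s V)
  case 0
  have "live s 0 \<subseteq> {[]}" by (auto simp: live_def)
  then have "card (live s 0) \<le> card {[]::'x list}" by (rule card_mono[rotated]) simp
  also have "\<dots> \<le> d ^ ((m - card V) + m + 1)" using d_ge_2 by simp
  finally show ?case .
next
  case (Suc n)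
  have sx: "sec s [x] \<in> S" if "x \<in> X" for x using that Suc.prems(1) by (simp add: step_in)
  have extend: "\<exists>w y. w \<in> lists X \<and> w \<noteq> [] \<and> sec t w = sec s [x] \<and> y \<in> X \<and> y \<noteq> hd w \<and>
      immortal (sec t [y])" if t: "t \<in> V" and x: "x \<in> X" for t x
  proof -
    obtain w y where "w \<in> lists X" "w \<noteq> []" "sec t w = s" "y \<in> X" "y \<noteq> hd w" "immortal (sec t [y])"
      using Suc.prems(3)[OF t] by blast
    then show ?thesis using x by (intro exI[of _ "w @ [x]"] exI[of _ y]) (simp add: sect_append)
  qed
  show ?case
  \<comment> \<open>Up to length \<open>m + 1\<close> all words are counted, which explains the
    summand \<open>m + 1\<close> of the exponent. Beyond it, a live continuation makes its state
    immortal.\<close>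
  proof (cases "Suc n \<le> m + 1")
    case True
    have "card (live s (Suc n)) \<le> card {v \<in> lists X. length v = Suc n}"
      by (intro card_mono) (auto simp: live_def)
    also have "\<dots> \<le> d ^ ((m - card V) + m + 1)"
      unfolding card_length using True d_ge_2 by (intro power_increasing) auto
    finally show ?thesis .
  next
    case False
    have immortal: "immortal (sec s [x])" if "x \<in> X" "live (sec s [x]) n \<noteq> {}" for x
      using immortal_if_live_card[OF sx[OF that(1)]] that(2) False by fastforce
    show ?thesis
    proof (cases "\<exists>x\<in>X. \<exists>y\<in>X. x \<noteq> y \<and> live (sec s [x]) n \<noteq> {} \<and> live (sec s [y]) n \<noteq> {}")
      case True
      \<comment> \<open>Two letters survive, so \<open>s\<close> is collected. The sum over the
        letters costs a factor \<open>d\<close>, paid for by the growth of \<open>V\<close>.\<close>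
      have "s \<notin> V"
      proof
        assume "s \<in> V"
        then show False using Suc.prems no_exit_from_cycle by blast
      qed
      then have cV: "card (insert s V) = Suc (card V)" "card (insert s V) \<le> m"
        using Suc.prems finite_subset[OF Suc.prems(2)] card_mono[OF finite_S, of "insert s V"]
        by (auto simp: m_def)
      have "card (live (sec s [x]) n) \<le> d ^ ((m - card (insert s V)) + m + 1)" if x: "x \<in> X" for x
      proof (cases "live (sec s [x]) n = {}")
        case False
        \<comment> \<open>For the branch \<open>x\<close> the second surviving letter
          \<open>y\<close> is the exit that witnesses the new member \<open>s\<close> of the
          collection.\<close>
        then obtain y where y: "y \<in> X" "y \<noteq> x" "live (sec s [y]) n \<noteq> {}" using True by metis
        show ?thesis
        proof (rule Suc.IH)
          fix t assume "t \<in> insert s V"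
          then show "\<exists>w y. w \<in> lists X \<and> w \<noteq> [] \<and> sec t w = sec s [x] \<and> y \<in> X \<and> y \<noteq> hd w \<and>
            immortal (sec t [y])"
          proof
            assume "t = s"
            then show ?thesis using x y immortal by (intro exI[of _ "[x]"] exI[of _ y]) auto
          qed (use extend x in blast)
        qed (use sx[OF x] Suc.prems in auto)
      qed simp
      then have "(\<Sum>x\<in>X. card (live (sec s [x]) n)) \<le> card X * d ^ ((m - card (insert s V)) + m + 1)"
        using sum_bounded_above[of X "\<lambda>x. card (live (sec s [x]) n)"
          "d ^ ((m - card (insert s V)) + m + 1)"] by simp
      also have "\<dots> = d ^ Suc ((m - card (insert s V)) + m + 1)" by (simp add: d_def)
      also have "Suc ((m - card (insert s V)) + m + 1) = (m - card V) + m + 1"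
        using cV by simp
      finally show ?thesis using card_live_Suc[of s n] by linarith
    next
      case False
      show ?thesis
      proof (cases "\<exists>x\<in>X. live (sec s [x]) n \<noteq> {}")
        case True
        then obtain x where x: "x \<in> X" "live (sec s [x]) n \<noteq> {}" by blast
        \<comment> \<open>With a single surviving letter only one summand is nonzero: no factor
          \<open>d\<close> is lost and \<open>V\<close> is unchanged.\<close>
        have "(\<Sum>y\<in>X. card (live (sec s [y]) n)) = card (live (sec s [x]) n)"
          using False x by (subst sum.remove[OF finite_X x(1)]) (auto intro!: sum.neutral)
        also have "\<dots> \<le> d ^ ((m - card V) + m + 1)"
          using sx[OF x(1)] Suc.prems extend x(1) by (intro Suc.IH) auto
        finally show ?thesis using card_live_Suc[of s n] by linarith
      next
        case False
        then have "(\<Sum>x\<in>X. card (live (sec s [x]) n)) = 0" by auto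
        then show ?thesis using card_live_Suc[of s n] by linarith
      qed
    qed
  qed
qed

lemma card_live: "s \<in> S \<Longrightarrow> card (live s n) \<le> d ^ (2 * m + 1)"
  using card_live_aux[of s "{}" n] by (simp add: mult_2)

text \<open>A port is a pair \<open>(s, v)\<close> with nontrivial section \<open>s|_v\<close>. In the next section its two ends
  \<open>v\<close> and \<open>s(v)\<close> are marked by \<open>False\<close> and \<open>True\<close>.\<close>

definition ports :: "nat \<Rightarrow> ('s \<times> 'x list) set" where
  "ports n = (SIGMA s:S. live s n)"

definition M :: nat where "M = m * d ^ (2 * m + 1)"

lemma finite_ports [simp]: "finite (ports n)" and card_ports: "card (ports n) \<le> M"
proof -
  show "finite (ports n)" by (simp add: ports_def)
  have "card (ports n) = (\<Sum>s\<in>S. card (live s n))" by (simp add: ports_def)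
  also have "\<dots> \<le> card S * d ^ (2 * m + 1)"
    using sum_bounded_above[of S "\<lambda>s. card (live s n)", OF card_live] by simp
  finally show "card (ports n) \<le> M" by (simp add: M_def m_def)
qed

end

section \<open>Pieces and their configurations\<close>

declare in_listsD [rule del] in_listsI [rule del]

type_synonym ('t, 'y) endpoint = "('t \<times> 'y list) \<times> bool"

context bounded_aut
begin

section \<open>Ties and pieces\<close>

definition T :: "('x list \<times> 'x list) set" where
  "T = {(v, act s v) | s v. s \<in> S \<and> v \<in> lists X \<and> triv (sec s v)}"

definition R :: "('x list \<times> 'x list) set" where
  "R = (T \<union> T\<inverse>)\<^sup>*"

lemma R_refl [simp]: "(v, v) \<in> R"
  by (simp add: R_def)

lemma R_trans: "(u, v) \<in> R \<Longrightarrow> (v, w) \<in> R \<Longrightarrow> (u, w) \<in> R"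
  by (simp add: R_def)

lemma R_sym: "(v, w) \<in> R \<Longrightarrow> (w, v) \<in> R"
  unfolding R_def by (metis converse_Un converse_converse converse_iff rtrancl_converse sup_commute)

lemma T_R: "(v, w) \<in> T \<Longrightarrow> (v, w) \<in> R"
  unfolding R_def by blast

lemma R_induct [consumes 1, case_names refl step]:
  assumes "(v, w) \<in> R" "P v"
    and "\<And>w w'. (v, w) \<in> R \<Longrightarrow> P w \<Longrightarrow> (w, w') \<in> T \<or> (w', w) \<in> T \<Longrightarrow> P w'"
  shows "P w"
  using assms(1) unfolding R_def
  by (induction rule: rtrancl_induct) (use assms(2,3) in \<open>auto simp: R_def\<close>)

lemma T_in: "(v, w) \<in> T \<Longrightarrow> v \<in> lists X \<and> w \<in> lists X \<and> length v = length w"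
  unfolding T_def using act_in by force

lemma R_in: "(v, w) \<in> R \<Longrightarrow> (v \<in> lists X \<longleftrightarrow> w \<in> lists X) \<and> length v = length w"
  by (induction rule: R_induct) (auto dest: T_in)

text \<open>The trivial section at a tie copies the suffix and remains trivial, so ties survive a
  common suffix.\<close>

lemma R_append:
  assumes "(v, w) \<in> R" "u \<in> lists X"
  shows "(v @ u, w @ u) \<in> R"
proof -
  have T: "(v @ u, w @ u) \<in> T" if "(v, w) \<in> T" for v w
  proof -
    obtain s where s: "s \<in> S" "v \<in> lists X" "triv (sec s v)" "w = act s v"
      using \<open>(v, w) \<in> T\<close> by (auto simp: T_def)
    then have "w @ u = act s (v @ u)" "triv (sec s (v @ u))"
      using assms(2) triv_sec by (simp_all add: sect_append action_append triv_iff)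
    then show ?thesis using s assms(2) unfolding T_def by auto
  qed
  show ?thesis using assms(1)
  proof (induction rule: R_induct)
    case (step w w')
    then show ?case using T[of w w'] T[of w' w] T_R R_sym R_trans by meson
  qed simp
qed

text \<open>The piece of \<open>v\<close>.\<close>

definition cls :: "'x list \<Rightarrow> 'x list set" where
  "cls v = R `` {v}"

lemma in_cls [simp]: "w \<in> cls v \<longleftrightarrow> (v, w) \<in> R"
  by (simp add: cls_def)

lemma cls_eq: "(v, w) \<in> R \<Longrightarrow> cls v = cls w"
  unfolding cls_def by (blast intro: R_sym R_trans)

lemma finite_cls [simp]: "v \<in> lists X \<Longrightarrow> finite (cls v)"
proof (rule finite_subset[OF _ finite_length[of "length v"]])
  show "v \<in> lists X \<Longrightarrow> cls v \<subseteq> {w \<in> lists X. length w = length v}"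
    using R_in[of v] by auto
qed

definition psec :: "'s \<times> 'x list \<Rightarrow> 's" where
  "psec p = sec (fst p) (snd p)"

definition ep :: "('s, 'x) endpoint \<Rightarrow> 'x list" where
  "ep e = (if snd e then act (fst (fst e)) (snd (fst e)) else snd (fst e))"

definition ends :: "nat \<Rightarrow> ('s, 'x) endpoint set" where
  "ends n = ports n \<times> UNIV"

lemma finite_ends [simp]: "finite (ends n)" and card_ends: "card (ends n) \<le> 2 * M"
  using card_ports[of n] by (simp_all add: ends_def card_cartesian_product)

lemma portsD: "p \<in> ports n \<Longrightarrow> fst p \<in> S \<and> snd p \<in> lists X \<and> length (snd p) = n \<and> psec p \<in> S"
  by (auto simp: ports_def live_def psec_def sec_in)

lemma ep_in: "e \<in> ends n \<Longrightarrow> ep e \<in> lists X \<and> length (ep e) = n"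
  by (auto simp: ends_def ep_def act_in dest!: portsD)

text \<open>If the section at the prefix of length \<open>n\<close> is trivial, the tie exists on
  level \<open>n\<close> already and the rest is copied. Otherwise state and prefix form a port, and
  its section transforms the rest.\<close>

lemma T_split:
  assumes "(z, z') \<in> T" "n \<le> length z"
  obtains (inside) b b' w where "z = b @ w" "z' = b' @ w" "length b = n" "length b' = n" "(b, b') \<in> T"
    "w \<in> lists X"
  | (port) p w where "p \<in> ports n" "z = ep (p, False) @ w" "z' = ep (p, True) @ act (psec p) w"
    "w \<in> lists X" "triv (sec (psec p) w)"
proof -
  obtain s where s: "s \<in> S" "z \<in> lists X" "triv (sec s z)" "z' = act s z"
    using assms(1) by (auto simp: T_def)
  define b w where "b = take n z" and "w = drop n z"
  have bw: "z = b @ w" "length b = n" using assms(2) by (auto simp: b_def w_def)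
  then have in_X: "b \<in> lists X" "w \<in> lists X" using s(2) by auto
  show thesis
  proof (cases "triv (sec s b)")
    case True
    then have "act (sec s b) w = w" using in_X by (simp add: triv_iff)
    then have "z' = act s b @ w" using s bw by (simp add: action_append)
    moreover have "(b, act s b) \<in> T" using True s in_X by (auto simp: T_def)
    ultimately show thesis using that(1) bw in_X by simp
  next
    case False
    then have "(s, b) \<in> ports n" using s bw in_X by (simp add: ports_def live_def)
    then show thesis using that(2)[of "(s, b)" w] s bw in_X
      by (simp add: ep_def psec_def action_append sect_append)
  qed
qed

text \<open>For words with a prefix that is an end on level \<open>n\<close>, the relation \<open>H n\<close> describes \<open>R\<close> in terms
  of the sections at the ports and of \<open>R\<close> among the ends on level \<open>n\<close> alone. These are the data
  preserved by \<open>iso\<close> below.\<close>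

definition Hstep :: "nat \<Rightarrow> ((('s, 'x) endpoint \<times> 'x list) \<times> (('s, 'x) endpoint \<times> 'x list)) set" where
  "Hstep n = {((e, u), (f, u)) | e f u. e \<in> ends n \<and> f \<in> ends n \<and> u \<in> lists X \<and> (ep e, ep f) \<in> R}
    \<union> {(((p, False), u), ((p, True), act (psec p) u)) | p u.
        p \<in> ports n \<and> u \<in> lists X \<and> triv (sec (psec p) u)}"

lemma Hstep_end: "e \<in> ends n \<Longrightarrow> f \<in> ends n \<Longrightarrow> u \<in> lists X \<Longrightarrow> (ep e, ep f) \<in> R \<Longrightarrow>
    ((e, u), (f, u)) \<in> Hstep n"
  unfolding Hstep_def by blast

lemma Hstep_port: "p \<in> ports n \<Longrightarrow> u \<in> lists X \<Longrightarrow> triv (sec (psec p) u) \<Longrightarrow>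
    (((p, False), u), ((p, True), act (psec p) u)) \<in> Hstep n"
  unfolding Hstep_def by blast

definition H where "H n = (Hstep n \<union> (Hstep n)\<inverse>)\<^sup>*"

lemma Hstep_H: "(a, b) \<in> Hstep n \<Longrightarrow> (a, b) \<in> H n \<and> (b, a) \<in> H n"
  unfolding H_def by blast

lemmas H_step1 = Hstep_H[OF Hstep_end, THEN conjunct1]
lemmas H_step2 = Hstep_H[OF Hstep_port, THEN conjunct1] Hstep_H[OF Hstep_port, THEN conjunct2]

lemma H_trans: "(a, b) \<in> H n \<Longrightarrow> (b, c) \<in> H n \<Longrightarrow> (a, c) \<in> H n"
  by (simp add: H_def)

lemma H_sound: "(a, b) \<in> H n \<Longrightarrow> (ep (fst a) @ snd a, ep (fst b) @ snd b) \<in> R"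
proof -
  have H_step_R: "(ep (fst a) @ snd a, ep (fst b) @ snd b) \<in> R" if "(a, b) \<in> Hstep n" for a b
    using that[unfolded Hstep_def]
  proof (elim UnE CollectE exE conjE)
    fix p u assume p: "(a, b) = (((p, False), u), ((p, True), act (psec p) u))" "p \<in> ports n"
      "u \<in> lists X" "triv (sec (psec p) u)"
    then have "(snd p @ u, act (fst p) (snd p @ u)) \<in> T"
      using portsD[of p n] unfolding T_def psec_def
      by (auto simp: sect_append)
    then show ?thesis using p by (simp add: ep_def action_append psec_def T_R)
  qed (auto intro: R_append)
  show "(a, b) \<in> H n \<Longrightarrow> ?thesis"
    unfolding H_def
  proof (induction rule: rtrancl_induct)
    case (step b c)
    then show ?case using H_step_R[of b c] H_step_R[of c b] R_trans R_sym by blast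
  qed simp
qed

text \<open>The chain of ties is followed one by one. An inside tie moves the prefix within a piece
  of level \<open>n\<close> and keeps the suffix; a port tie is a step of \<open>H\<close>. It
  therefore suffices to remember some end \<open>f\<close> in the piece of the current
  prefix.\<close>

lemma H_complete:
  assumes e: "e \<in> ends n" "u \<in> lists X" and z: "(ep e @ u, z) \<in> R"
  shows "\<exists>b f w. z = b @ w \<and> length b = n \<and> f \<in> ends n \<and> w \<in> lists X \<and> (b, ep f) \<in> R \<and>
    ((e, u), (f, w)) \<in> H n"
  using z
proof (induction rule: R_induct)
  case refl
  have "((e, u), (e, u)) \<in> H n" by (simp add: H_def)
  then show ?case
    using e ep_in[OF e(1)] by (intro exI[of _ "ep e"] exI[of _ e] exI[of _ u]) simp
next
  case (step z z')
  obtain b f w where z: "z = b @ w" "length b = n" and f: "f \<in> ends n" "w \<in> lists X"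
    "(b, ep f) \<in> R" "((e, u), (f, w)) \<in> H n"
    using step.IH by blast
  have len: "n \<le> length z" "n \<le> length z'" using z step.hyps T_in[of z z'] T_in[of z' z] by auto
  have ends: "p \<in> ports n \<Longrightarrow> (p, c) \<in> ends n" for p c by (simp add: ends_def)
  have result: ?case if "z' = b @ w" "length b = n" "f \<in> ends n" "w \<in> lists X" "(b, ep f) \<in> R"
    "((e, u), (f, w)) \<in> H n" for b f w
    using that by blast
  \<comment> \<open>Before a port is crossed, the remembered end is exchanged for the end of that
    port, which lies in the same piece.\<close>
  have jump: "((e, u), (g, w)) \<in> H n" if "ep g = b" "g \<in> ends n" for g
  proof (rule H_trans[OF f(4)], rule H_step1)
    show "(ep f, ep g) \<in> R" using that f(3) R_sym by simp
  qed (use f that in auto)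
  from step.hyps(2) show ?case
  proof
    assume "(z, z') \<in> T"
    from this len(1) show ?thesis
    proof (cases rule: T_split)
      case (inside c c' w')
      then have eq: "c = b" "w' = w" using z by auto
      then have "(c', ep f) \<in> R" using R_trans[OF R_sym[OF T_R[OF inside(5)]]] f(3) by simp
      then show ?thesis using result[OF inside(2) inside(4) f(1)] f eq by simp
    next
      case (port p w')
      then have eq: "ep (p, False) = b" "w' = w" using z ep_in[OF ends, of p False] by auto
      have "((e, u), ((p, True), act (psec p) w)) \<in> H n"
        using H_trans[OF jump[OF eq(1) ends]] H_step2(1)[of p n w'] port eq by simp
      moreover have "act (psec p) w \<in> lists X" using port eq portsD[of p n] act_in by simp
      ultimately show ?thesis
        using result[OF port(3), of "(p, True)"] port eq ends ep_in[OF ends, of p True] by simp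
    qed
  next
    assume "(z', z) \<in> T"
    from this len(2) show ?thesis
    proof (cases rule: T_split)
      case (inside c c' w')
      then have eq: "c' = b" "w' = w" using z by auto
      then have "(c, ep f) \<in> R" using R_trans[OF T_R[OF inside(5)]] f(3) by simp
      then show ?thesis using result[OF inside(1) inside(3) f(1)] f eq by simp
    next
      case (port p w')
      then have eq: "ep (p, True) = b" "act (psec p) w' = w"
        using z ep_in[OF ends, of p True] by auto
      have "((e, u), ((p, False), w')) \<in> H n"
        using H_trans[OF jump[OF eq(1) ends]] H_step2(2)[of p n w'] port eq by simp
      then show ?thesis
        using result[OF port(2), of "(p, False)"] port ends ep_in[OF ends, of p False] by simp
    qed
  qed
qed

text \<open>This expresses \<open>R\<close> between extended ends through level-\<open>n\<close>
  data that can be transported to another level.\<close>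

lemma H_iff_R:
  assumes e: "e \<in> ends n" and f: "f \<in> ends n" and u: "u \<in> lists X"
  shows "((e, u), (f, w)) \<in> H n \<longleftrightarrow> (ep e @ u, ep f @ w) \<in> R"
proof
  assume "(ep e @ u, ep f @ w) \<in> R"
  from H_complete[OF e u this] obtain b g w' where
    g: "ep f @ w = b @ w'" "length b = n" "g \<in> ends n" "w' \<in> lists X" "(b, ep g) \<in> R"
    "((e, u), (g, w')) \<in> H n" by blast
  moreover have "length (ep f) = n" using ep_in[OF f] by simp
  ultimately have "b = ep f" "w' = w" by auto
  then have "(ep g, ep f) \<in> R" "g \<in> ends n" "w \<in> lists X" "((e, u), (g, w)) \<in> H n"
    using g R_sym by blast+
  then show "((e, u), (f, w)) \<in> H n" using H_trans[OF _ H_step1[of g n f w]] f by simp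
next
  assume "((e, u), (f, w)) \<in> H n"
  from H_sound[OF this] show "(ep e @ u, ep f @ w) \<in> R" by simp
qed

text \<open>Crossing a port would require an end in the piece of \<open>a\<close>. Without one, all
  ties of the chain are inside and leave the suffix alone.\<close>

lemma R_append_isolated:
  assumes a: "\<And>e. e \<in> ends (length a) \<Longrightarrow> (a, ep e) \<notin> R" and z: "(a @ u, z) \<in> R"
  shows "\<exists>b. z = b @ u \<and> (a, b) \<in> R"
  using z
proof (induction rule: R_induct)
  case (step z z')
  obtain b where z: "z = b @ u" "(a, b) \<in> R" using step.IH by blast
  have lb: "length b = length a" using R_in[OF z(2)] by simp
  have len: "length a \<le> length z" "length a \<le> length z'"
    using z lb step.hyps(2) T_in[of z z'] T_in[of z' z] by auto
  have no_port: "b \<noteq> ep (p, c)" if "p \<in> ports (length a)" for p c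
    using a[of "(p, c)"] that z(2) by (auto simp: ends_def)
  have ends: "p \<in> ports (length a) \<Longrightarrow> (p, c) \<in> ends (length a)" for p c by (simp add: ends_def)
  from step.hyps(2) show ?case
  proof
    assume "(z, z') \<in> T"
    from this len(1) show ?thesis
    proof (cases rule: T_split)
      case (inside c c' w)
      then show ?thesis using z lb T_R R_trans by (metis append_eq_append_conv)
    next
      case (port p w)
      then show ?thesis using z lb no_port ep_in[OF ends, of p False]
        by (metis append_eq_append_conv)
    qed
  next
    assume "(z', z) \<in> T"
    from this len(2) show ?thesis
    proof (cases rule: T_split)
      case (inside c c' w)
      then show ?thesis using z lb T_R R_trans R_sym by (metis append_eq_append_conv)
    next
      case (port p w)
      then show ?thesis using z lb no_port ep_in[OF ends, of p True]
        by (metis append_eq_append_conv)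
    qed
  qed
qed auto

lemma cls_append_isolated:
  assumes "\<And>e. e \<in> ends (length a) \<Longrightarrow> (a, ep e) \<notin> R" "u \<in> lists X"
  shows "cls (a @ u) = (\<lambda>b. b @ u) ` cls a"
proof (intro Set.set_eqI iffI)
  fix z assume "z \<in> cls (a @ u)"
  then show "z \<in> (\<lambda>b. b @ u) ` cls a" using R_append_isolated[OF assms(1), of u z] by auto
next
  fix z assume "z \<in> (\<lambda>b. b @ u) ` cls a"
  then show "z \<in> cls (a @ u)" using R_append[OF _ assms(2)] by auto
qed

section \<open>Isomorphic levels, that is levels with the same configuration\<close>

definition iso :: "nat \<Rightarrow> nat \<Rightarrow> ('s \<times> 'x list \<Rightarrow> 's \<times> 'x list) \<Rightarrow> bool" where
  "iso n n' \<phi> \<longleftrightarrow> bij_betw \<phi> (ports n) (ports n') \<and> (\<forall>p\<in>ports n. psec (\<phi> p) = psec p) \<and>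
    (\<forall>e\<in>ends n. \<forall>f\<in>ends n. (ep (apfst \<phi> e), ep (apfst \<phi> f)) \<in> R \<longleftrightarrow> (ep e, ep f) \<in> R)"

lemma iso_ends: "iso n n' \<phi> \<Longrightarrow> e \<in> ends n \<Longrightarrow> apfst \<phi> e \<in> ends n'"
  by (auto simp: iso_def ends_def bij_betw_def)

lemma iso_port: "iso n n' \<phi> \<Longrightarrow> p \<in> ports n \<Longrightarrow> \<phi> p \<in> ports n' \<and> psec (\<phi> p) = psec p"
  by (auto simp: iso_def bij_betw_def)

lemma iso_inv:
  assumes "iso n n' \<phi>"
  shows "iso n' n (inv_into (ports n) \<phi>)"
    and "p \<in> ports n' \<Longrightarrow> \<phi> (inv_into (ports n) \<phi> p) = p"
    and "p \<in> ports n \<Longrightarrow> inv_into (ports n) \<phi> (\<phi> p) = p"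
proof -
  let ?\<psi> = "inv_into (ports n) \<phi>"
  have bij: "bij_betw \<phi> (ports n) (ports n')" using assms by (simp add: iso_def)
  show 1: "\<phi> (?\<psi> p) = p" if "p \<in> ports n'" for p
    using that bij by (simp add: bij_betw_inv_into_right)
  show "?\<psi> (\<phi> p) = p" if "p \<in> ports n" for p
    using that bij by (simp add: bij_betw_inv_into_left)
  have 2: "?\<psi> p \<in> ports n" if "p \<in> ports n'" for p
    using that bij by (metis bij_betw_def inv_into_into)
  have 3: "apfst ?\<psi> e \<in> ends n \<and> apfst \<phi> (apfst ?\<psi> e) = e" if "e \<in> ends n'" for e
    using that 1 2 by (auto simp: ends_def)
  show "iso n' n ?\<psi>"
    unfolding iso_def
  proof (intro conjI ballI)
    show "bij_betw ?\<psi> (ports n') (ports n)" using bij by (rule bij_betw_inv_into)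
    show "psec (?\<psi> p) = psec p" if "p \<in> ports n'" for p
      using iso_port[OF assms 2[OF that]] 1[OF that] by simp
    show "(ep (apfst ?\<psi> e), ep (apfst ?\<psi> f)) \<in> R \<longleftrightarrow> (ep e, ep f) \<in> R"
      if "e \<in> ends n'" "f \<in> ends n'" for e f
      using 3[OF that(1)] 3[OF that(2)] assms unfolding iso_def by metis
  qed
qed

lemma iso_comp:
  assumes "iso n n' \<phi>" "iso n' n'' \<psi>"
  shows "iso n n'' (\<psi> \<circ> \<phi>)"
proof -
  have eq: "apfst (\<psi> \<circ> \<phi>) e = apfst \<psi> (apfst \<phi> e)" for e by (cases e) simp
  show ?thesis
    unfolding iso_def
  proof (intro conjI ballI)
    show "bij_betw (\<psi> \<circ> \<phi>) (ports n) (ports n'')"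
      using assms by (auto simp: iso_def intro: bij_betw_trans)
    show "psec ((\<psi> \<circ> \<phi>) p) = psec p" if "p \<in> ports n" for p
      using iso_port[OF assms(1) that] iso_port[OF assms(2)] by simp
    show "(ep (apfst (\<psi> \<circ> \<phi>) e), ep (apfst (\<psi> \<circ> \<phi>) f)) \<in> R \<longleftrightarrow> (ep e, ep f) \<in> R"
      if "e \<in> ends n" "f \<in> ends n" for e f
      using that assms iso_ends[OF assms(1)] unfolding eq iso_def by blast
  qed
qed

lemma iso_H:
  assumes iso: "iso n n' \<phi>" and "(a, b) \<in> H n"
  shows "((apfst \<phi> (fst a), snd a), (apfst \<phi> (fst b), snd b)) \<in> H n'"
proof -
  have "((apfst \<phi> (fst a), snd a), (apfst \<phi> (fst b), snd b)) \<in> Hstep n'"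
    if "(a, b) \<in> Hstep n" for a b
    using that[unfolded Hstep_def]
  proof (elim UnE CollectE exE conjE)
    fix e f u assume *: "(a, b) = ((e, u), (f, u))" "e \<in> ends n" "f \<in> ends n" "u \<in> lists X"
      "(ep e, ep f) \<in> R"
    then have "(ep (apfst \<phi> e), ep (apfst \<phi> f)) \<in> R" using iso by (auto simp: iso_def)
    then show ?thesis using * iso_ends[OF iso] Hstep_end by simp
  next
    fix p u assume *: "(a, b) = (((p, False), u), ((p, True), act (psec p) u))" "p \<in> ports n"
      "u \<in> lists X" "triv (sec (psec p) u)"
    then show ?thesis using iso_port[OF iso, of p] Hstep_port[of "\<phi> p" n' u] by simp
  qed
  with assms(2) show ?thesis
    unfolding H_def
    by (induction rule: rtrancl_induct) (auto intro: rtrancl_into_rtrancl)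
qed

text \<open>By \<open>H_iff_R\<close> both sides are statements about \<open>H\<close>, which
  \<open>\<phi>\<close> and its inverse preserve.\<close>

lemma iso_R:
  assumes iso: "iso n n' \<phi>" and e: "e \<in> ends n" and f: "f \<in> ends n" and u: "u \<in> lists X"
  shows "(ep (apfst \<phi> e) @ u, ep (apfst \<phi> f) @ w) \<in> R \<longleftrightarrow> (ep e @ u, ep f @ w) \<in> R"
proof -
  let ?\<psi> = "inv_into (ports n) \<phi>"
  have inv: "apfst ?\<psi> (apfst \<phi> g) = g" if "g \<in> ends n" for g
    using iso_inv(3)[OF iso] that by (auto simp: ends_def)
  show ?thesis
    using iso_H[OF iso, of "(e, u)" "(f, w)"] inv[OF e] inv[OF f]
      iso_H[OF iso_inv(1)[OF iso], of "(apfst \<phi> e, u)" "(apfst \<phi> f, w)"]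
    by (auto simp: H_iff_R[OF e f u, symmetric]
        H_iff_R[OF iso_ends[OF iso e] iso_ends[OF iso f] u, symmetric])
qed

definition extend :: "nat \<Rightarrow> ('s \<times> 'x list \<Rightarrow> 's \<times> 'x list) \<Rightarrow> 's \<times> 'x list \<Rightarrow> 's \<times> 'x list" where
  "extend n \<phi> p = (let q = \<phi> (fst p, take n (snd p)) in (fst q, snd q @ drop n (snd p)))"

lemma ports_split:
  assumes "p \<in> ports (n + k)"
  obtains q u where "p = (fst q, snd q @ u)" "q \<in> ports n" "u \<in> lists X" "length u = k"
    "psec p = sec (psec q) u"
proof
  let ?q = "(fst p, take n (snd p))" and ?u = "drop n (snd p)"
  have "take n (snd p) \<in> live (fst p) n"
    using assms live_take[of "snd p" "fst p" "n + k" n] by (auto simp: ports_def)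
  then show "?q \<in> ports n" using assms by (auto simp: ports_def)
  show "p = (fst ?q, snd ?q @ ?u)" by simp
  show "?u \<in> lists X" "length ?u = k"
    using portsD[OF assms] by (auto simp: in_lists_conv_set dest: in_set_dropD)
  show "psec p = sec (psec ?q) ?u" by (simp add: psec_def flip: sect_append)
qed

lemma extend_append:
  "q \<in> ports n \<Longrightarrow> extend n \<phi> (fst q, snd q @ u) = (fst (\<phi> q), snd (\<phi> q) @ u)"
  using portsD[of q n] by (simp add: extend_def Let_def)

lemma psec_append: "psec (fst q, snd q @ u) = sec (psec q) u"
  by (simp add: psec_def sect_append)

lemma ports_append: "q \<in> ports n \<Longrightarrow> u \<in> lists X \<Longrightarrow> \<not> triv (sec (psec q) u) \<Longrightarrow>
    (fst q, snd q @ u) \<in> ports (n + length u)"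
  by (auto simp: ports_def live_def psec_def sect_append)

text \<open>The suffix \<open>y\<close> depends only on the section at the prefix port, which
  isomorphisms preserve. One choice of \<open>f\<close> and \<open>y\<close> thus describes the
  images under all of them.\<close>

lemma ends_split:
  assumes "e \<in> ends (n + k)"
  obtains f y where "f \<in> ends n" "y \<in> lists X" "length y = k" "ep e = ep f @ y"
    "\<And>n' \<phi>. iso n n' \<phi> \<Longrightarrow> ep (apfst (extend n \<phi>) e) = ep (apfst \<phi> f) @ y"
proof -
  have "fst e \<in> ports (n + k)" using assms by (auto simp: ends_def)
  then obtain q u where q: "fst e = (fst q, snd q @ u)" "q \<in> ports n" "u \<in> lists X" "length u = k"
    by (rule ports_split)
  let ?y = "if snd e then act (psec q) u else u"
  show thesis
  proof (rule that)
    show "(q, snd e) \<in> ends n" using q by (simp add: ends_def)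
    show "?y \<in> lists X" "length ?y = k" using q portsD[OF q(2)] by (simp_all add: act_in)
    show "ep e = ep (q, snd e) @ ?y" using q by (simp add: ep_def action_append psec_def)
    show "ep (apfst (extend n \<phi>) e) = ep (apfst \<phi> (q, snd e)) @ ?y" if "iso n n' \<phi>" for n' \<phi>
    proof -
      have "apfst (extend n \<phi>) e = ((fst (\<phi> q), snd (\<phi> q) @ u), snd e)"
        using q extend_append[OF q(2)] by (cases e) simp
      moreover have "sec (fst (\<phi> q)) (snd (\<phi> q)) = psec q"
        using iso_port[OF that q(2)] by (simp add: psec_def)
      ultimately show ?thesis by (simp add: ep_def action_append)
    qed
  qed
qed

text \<open>A configuration determines its successors: ports of level \<open>n + k\<close> are ports
  of level \<open>n\<close> prolonged by words with nontrivial section, and \<open>iso_R\<close>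
  compares the pieces of their ends.\<close>

lemma iso_extend:
  assumes iso: "iso n n' \<phi>"
  shows "iso (n + k) (n' + k) (extend n \<phi>)"
proof -
  have port: "extend n \<phi> p \<in> ports (n' + k) \<and> psec (extend n \<phi> p) = psec p"
    if iso: "iso n n' \<phi>" and "p \<in> ports (n + k)" for n n' \<phi> p
  proof -
    from \<open>p \<in> ports (n + k)\<close> obtain q u where
      q: "p = (fst q, snd q @ u)" "q \<in> ports n" "u \<in> lists X" "length u = k"
      "psec p = sec (psec q) u" by (rule ports_split)
    have "\<not> triv (psec p)" using that by (auto simp: ports_def live_def psec_def)
    then show ?thesis
      using q iso_port[OF iso q(2)] ports_append[of "\<phi> q" n' u]
      by (simp add: extend_append psec_append)
  qed
  have inv: "extend n' \<psi> (extend n \<phi> p) = p"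
    if iso: "iso n n' \<phi>" and \<psi>: "\<And>q. q \<in> ports n \<Longrightarrow> \<psi> (\<phi> q) = q" and "p \<in> ports (n + k)"
    for n n' \<phi> \<psi> p
  proof -
    from \<open>p \<in> ports (n + k)\<close> obtain q u where q: "p = (fst q, snd q @ u)" "q \<in> ports n"
      by (rule ports_split)
    then show ?thesis
      using iso_port[OF iso q(2)] by (simp add: extend_append \<psi>)
  qed
  let ?\<psi> = "inv_into (ports n) \<phi>"
  show ?thesis
    unfolding iso_def
  proof (intro conjI ballI)
    show "bij_betw (extend n \<phi>) (ports (n + k)) (ports (n' + k))"
      by (rule bij_betw_byWitness[where f' = "extend n' ?\<psi>"])
        (use iso iso_inv[OF iso] port inv in auto)
    show "psec (extend n \<phi> p) = psec p" if "p \<in> ports (n + k)" for p using port[OF iso that] by simp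
    fix e f assume "e \<in> ends (n + k)" "f \<in> ends (n + k)"
    from ends_split[OF this(1)] ends_split[OF this(2)] obtain e' f' y z where
      e: "e' \<in> ends n" "y \<in> lists X" "ep e = ep e' @ y"
        "ep (apfst (extend n \<phi>) e) = ep (apfst \<phi> e') @ y" and
      f: "f' \<in> ends n" "ep f = ep f' @ z" "ep (apfst (extend n \<phi>) f) = ep (apfst \<phi> f') @ z"
      using iso by metis
    then show "(ep (apfst (extend n \<phi>) e), ep (apfst (extend n \<phi>) f)) \<in> R \<longleftrightarrow> (ep e, ep f) \<in> R"
      using iso_R[OF iso e(1) f(1) e(2)] by simp
  qed
qed

end

section \<open>Growth of pieces\<close>

type_synonym 't code = "(nat \<times> 't) set \<times> ((nat \<times> bool) \<times> (nat \<times> bool)) set"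

context bounded_aut
begin

section \<open>Counting configurations\<close>

definition enum :: "nat \<Rightarrow> nat \<Rightarrow> 's \<times> 'x list" where
  "enum n = (SOME h. bij_betw h {..<card (ports n)} (ports n))"

lemma enum: "bij_betw (enum n) {..<card (ports n)} (ports n)"
  using someI_ex[OF ex_bij_betw_nat_finite[OF finite_ports[of n]]]
  by (simp add: enum_def lessThan_atLeast0)


text \<open>The configuration with ports replaced by their numbers, so that its values range over a
  finite set independent of the level. Equal codes yield isomorphic levels.\<close>

definition code :: "nat \<Rightarrow> (nat \<times> 's) set \<times> ((nat \<times> bool) \<times> (nat \<times> bool)) set" where
  "code n = ((\<lambda>i. (i, psec (enum n i))) ` {..<card (ports n)},
    {(a, b). fst a < card (ports n) \<and> fst b < card (ports n) \<and>
      (ep (apfst (enum n) a), ep (apfst (enum n) b)) \<in> R})"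

definition codes :: "((nat \<times> 's) set \<times> ((nat \<times> bool) \<times> (nat \<times> bool)) set) set" where
  "codes = Pow ({..<M} \<times> S) \<times> Pow (({..<M} \<times> UNIV) \<times> ({..<M} \<times> UNIV))"

lemma finite_codes: "finite codes" and card_codes: "card codes = 2 ^ (M * m) * 2 ^ (2 * M * (2 * M))"
  by (simp_all add: codes_def card_cartesian_product card_Pow m_def mult.commute mult.left_commute)

lemma enum_port: "i < card (ports n) \<Longrightarrow> enum n i \<in> ports n"
  using enum[of n] by (auto simp: bij_betw_def)

lemma code_in: "code n \<in> codes"
  using card_ports[of n] portsD[OF enum_port[of _ n]] by (fastforce simp: code_def codes_def)

lemma code_iso:
  assumes "code n = code n'"
  obtains \<phi> where "iso n n' \<phi>" "card (ports n) = card (ports n')"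
    "\<And>i. i < card (ports n) \<Longrightarrow> \<phi> (enum n i) = enum n' i"
proof -
  have "fst ` fst (code k) = {..<card (ports k)}" for k
    by (simp add: code_def image_image)
  then have card: "card (ports n) = card (ports n')" using assms by (metis lessThan_eq_iff)
  define \<phi> where "\<phi> = enum n' \<circ> inv_into {..<card (ports n)} (enum n)"
  have \<phi>: "\<phi> (enum n i) = enum n' i" if "i < card (ports n)" for i
    using that enum[of n] by (simp add: \<phi>_def bij_betw_inv_into_left)
  have ex: "\<exists>i<card (ports n). p = enum n i" if "p \<in> ports n" for p
    using that enum[of n] by (auto simp: bij_betw_def)
  have psec: "psec (enum n' i) = psec (enum n i)" if "i < card (ports n)" for i
  proof -
    have "(i, psec (enum n i)) \<in> fst (code n')"
      unfolding assms[symmetric] using that by (simp add: code_def)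
    then show ?thesis by (auto simp: code_def)
  qed
  have R: "(ep (enum n' i, b), ep (enum n' j, c)) \<in> R \<longleftrightarrow> (ep (enum n i, b), ep (enum n j, c)) \<in> R"
    if "i < card (ports n)" "j < card (ports n)" for i j b c
  proof -
    have "((i, b), (j, c)) \<in> snd (code n) \<longleftrightarrow> ((i, b), (j, c)) \<in> snd (code n')" using assms by simp
    then show ?thesis using that card by (simp add: code_def)
  qed
  have "iso n n' \<phi>"
    unfolding iso_def
  proof (intro conjI ballI)
    show "bij_betw \<phi> (ports n) (ports n')"
      unfolding \<phi>_def using enum[of n] enum[of n'] card by (metis bij_betw_inv_into bij_betw_trans)
    show "psec (\<phi> p) = psec p" if "p \<in> ports n" for p
      using ex[OF that] \<phi> psec by auto
    show "(ep (apfst \<phi> e), ep (apfst \<phi> f)) \<in> R \<longleftrightarrow> (ep e, ep f) \<in> R"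
      if e: "e \<in> ends n" and f: "f \<in> ends n" for e f
    proof -
      have "fst e \<in> ports n" "fst f \<in> ports n" using e f by (auto simp: ends_def)
      then obtain i j where "i < card (ports n)" "fst e = enum n i" "j < card (ports n)" "fst f = enum n j"
        using ex by blast
      then have "e = (enum n i, snd e)" "f = (enum n j, snd f)" "i < card (ports n)" "j < card (ports n)"
        by (simp_all add: prod_eq_iff)
      then show ?thesis using R[of i j "snd e" "snd f"] \<phi> by (metis apfst_conv)
    qed
  qed
  then show thesis using that card \<phi> by blast
qed

text \<open>A configuration with a distinguished end: growth repeats only if the end of the same
  piece recurs, not merely the configuration.\<close>

definition mark :: "nat \<Rightarrow> ('s, 'x) endpoint \<Rightarrow> 's code \<times> (nat \<times> bool)" where
  "mark n e = (code n, apfst (inv_into {..<card (ports n)} (enum n)) e)"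

definition marks :: "('s code \<times> (nat \<times> bool)) set" where
  "marks = codes \<times> ({..<M} \<times> UNIV)"

definition K :: nat where "K = 2 ^ (M * m) * 2 ^ (2 * M * (2 * M)) * (2 * M)"

lemma finite_marks: "finite marks" and card_marks: "card marks = K"
  using finite_codes by (simp_all add: marks_def card_cartesian_product card_codes K_def mult.commute)

lemma inv_enum: "p \<in> ports n \<Longrightarrow> inv_into {..<card (ports n)} (enum n) p < card (ports n)"
    "p \<in> ports n \<Longrightarrow> enum n (inv_into {..<card (ports n)} (enum n) p) = p"
  using enum[of n] by (auto simp: bij_betw_inv_into_right bij_betw_def
      intro: inv_into_into[of _ "enum n" "{..<card (ports n)}", simplified])

lemma mark_in: "e \<in> ends n \<Longrightarrow> mark n e \<in> marks"
  using code_in[of n] inv_enum(1)[of "fst e" n] card_ports[of n]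
  by (cases e) (auto simp: mark_def marks_def ends_def)

lemma mark_iso:
  assumes eq: "mark n e = mark n' e'" and e: "e \<in> ends n" and e': "e' \<in> ends n'"
  obtains \<phi> where "iso n n' \<phi>" "apfst \<phi> e = e'"
proof -
  have code: "code n = code n'" using eq by (simp add: mark_def)
  from code_iso[OF this] obtain \<phi> where \<phi>: "iso n n' \<phi>" "card (ports n) = card (ports n')"
    "\<And>i. i < card (ports n) \<Longrightarrow> \<phi> (enum n i) = enum n' i" by blast
  let ?i = "inv_into {..<card (ports n)} (enum n) (fst e)"
  let ?i' = "inv_into {..<card (ports n')} (enum n') (fst e')"
  have p: "fst e \<in> ports n" "fst e' \<in> ports n'" using e e' by (auto simp: ends_def)
  have "?i = ?i'" "snd e = snd e'" using eq by (cases e; cases e'; simp add: mark_def)+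
  then have "\<phi> (fst e) = fst e'"
    using \<phi>(3)[of ?i] inv_enum[OF p(1)] inv_enum[OF p(2)] by simp
  then have "apfst \<phi> e = e'" using \<open>snd e = snd e'\<close> by (cases e; cases e') simp
  then show thesis using that \<phi>(1) by blast
qed

text \<open>The piece of \<open>e\<close> recurs, properly enlarged, \<open>p\<close> levels later. Transporting this along
  isomorphisms repeats the enlargement.\<close>

lemma growth:
  assumes iso: "iso i (i + p) \<phi>" and e: "e \<in> ends i" and f: "f \<in> ends i"
    and u: "u \<in> lists X" "length u = p" and w: "length w = p"
    and up: "(ep e @ u, ep (apfst \<phi> e)) \<in> R" and side: "(ep e @ u, ep f @ w) \<in> R"
    and new: "\<not> (w = u \<and> (ep e, ep f) \<in> R)"
  shows "\<exists>l \<psi>. iso i l \<psi> \<and> k < card (cls (ep (apfst \<psi> e)))"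
proof (induction k)
  case 0
  have "iso i i id" by (simp add: iso_def)
  moreover have "0 < card (cls (ep e))"
    using ep_in[OF e] R_refl[of "ep e"] finite_cls[of "ep e"]
    by (auto simp: card_gt_0_iff simp del: R_refl)
  ultimately have "iso i i id \<and> 0 < card (cls (ep (apfst id e)))" by simp
  then show ?case by blast
next
  case (Suc k)
  then obtain l \<psi> where \<psi>: "iso i l \<psi>" "k < card (cls (ep (apfst \<psi> e)))" by blast
  \<comment> \<open>First \<open>\<phi>\<close> leads from level \<open>i\<close> to
    \<open>i + p\<close>, then the prolonged \<open>\<psi>\<close> from there to
    \<open>l + p\<close>.\<close>
  define \<psi>' where "\<psi>' = extend i \<psi> \<circ> \<phi>"
  have iso': "iso i (l + p) \<psi>'" unfolding \<psi>'_def by (rule iso_comp[OF iso iso_extend[OF \<psi>(1)]])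
  define E where "E = ep (apfst \<psi> e)"
  define F where "F = ep (apfst \<psi> f)"
  have EF: "E \<in> lists X" "length E = l" "length F = l"
    using ep_in[OF iso_ends[OF \<psi>(1) e]] ep_in[OF iso_ends[OF \<psi>(1) f]] by (simp_all add: E_def F_def)
  have "(E @ u, ep (apfst \<psi>' e)) \<in> R"
  proof -
    \<comment> \<open>Splitting the end of level \<open>i + p\<close> at level \<open>i\<close>
      turns \<open>up\<close> into a statement about ends of level \<open>i\<close>, which
      \<open>\<psi>\<close> transports.\<close>
    from ends_split[OF iso_ends[OF iso e]] obtain g y where g: "g \<in> ends i" "y \<in> lists X"
      "ep (apfst \<phi> e) = ep g @ y"
      "\<And>n' \<phi>'. iso i n' \<phi>' \<Longrightarrow> ep (apfst (extend i \<phi>') (apfst \<phi> e)) = ep (apfst \<phi>' g) @ y" by blast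
    have "apfst \<psi>' e = apfst (extend i \<psi>) (apfst \<phi> e)" by (cases e) (simp add: \<psi>'_def)
    then have "ep (apfst \<psi>' e) = ep (apfst \<psi> g) @ y" using g(4)[OF \<psi>(1)] by simp
    then show ?thesis using iso_R[OF \<psi>(1) e g(1) u(1)] up g(3) by (simp add: E_def)
  qed
  then have cls: "cls (ep (apfst \<psi>' e)) = cls (E @ u)" by (simp add: cls_eq)
  \<comment> \<open>The new piece contains a copy of \<open>cls E\<close> and, outside that copy by
    \<open>new\<close>, the word \<open>F @ w\<close>; so it is strictly larger.\<close>
  have "F @ w \<in> cls (E @ u)"
    using iso_R[OF \<psi>(1) e f u(1)] side by (simp add: E_def F_def)
  moreover have "(\<lambda>b. b @ u) ` cls E \<subseteq> cls (E @ u)"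
    using R_append u by auto
  moreover have notin: "F @ w \<notin> (\<lambda>b. b @ u) ` cls E"
  proof
    assume "F @ w \<in> (\<lambda>b. b @ u) ` cls E"
    then obtain b where "F @ w = b @ u" "(E, b) \<in> R" by auto
    then have "w = u" "(E, F) \<in> R" using u w by auto
    then show False using new \<psi>(1) e f unfolding iso_def E_def F_def by blast
  qed
  ultimately have "insert (F @ w) ((\<lambda>b. b @ u) ` cls E) \<subseteq> cls (E @ u)" by blast
  then have "card (insert (F @ w) ((\<lambda>b. b @ u) ` cls E)) \<le> card (cls (E @ u))"
    using EF u by (intro card_mono) auto
  moreover have "card (insert (F @ w) ((\<lambda>b. b @ u) ` cls E)) = Suc (card (cls E))"
    using notin EF by (simp add: card_image inj_on_def)
  ultimately show ?case
    using \<psi>(2) iso' unfolding E_def[symmetric] cls[symmetric]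
    by (intro exI[of _ "l + p"] exI[of _ \<psi>']) simp
qed

section \<open>An explicit bound on the sizes of pieces\<close>

definition D :: nat where "D = 2 * M * d + 1"

text \<open>The set \<open>V\<close> collects the marks met on the descent from a large piece to its ancestors, each
  time the piece is composed of more than one copy of pieces of the previous level. By \<open>growth\<close> no
  mark can be collected twice.\<close>

lemma card_cls_aux:
  assumes bnd: "\<And>v. v \<in> lists X \<Longrightarrow> card (cls v) \<le> Q"
  assumes "a \<in> lists X" "length a = n" "V \<subseteq> marks"
    and "\<And>\<nu>. \<nu> \<in> V \<Longrightarrow> \<exists>j e u. e \<in> ends j \<and> u \<in> lists X \<and> j = n + length u \<and> \<nu> = mark j e \<and>
      (a @ u, ep e) \<in> R"
  shows "card (cls a) \<le> D ^ (K - card V)"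
  using assms(2-)
proof (induction n arbitrary: a V)
  case 0
  have "cls a \<subseteq> {[]}" using 0 R_in[of a] by auto
  then have "card (cls a) \<le> card {[] :: 'x list}" by (intro card_mono) auto
  \<comment> \<open>The summand 1 in \<open>D\<close> makes this power positive even if
    \<open>M = 0\<close>.\<close>
  also have "\<dots> \<le> D ^ (K - card V)" using one_le_power[of D "K - card V"] by (simp add: D_def)
  finally show ?case .
next
  case (Suc n)
  obtain b x where a: "a = b @ [x]" "length b = n"
    using Suc.prems(2) by (metis length_Suc_conv_rev)
  have bx: "b \<in> lists X" "x \<in> X" using Suc.prems(1) a by auto
  show ?case
  \<comment> \<open>Either the piece is a copy of a part of \<open>cls b\<close>, and the descent
    continues without a new mark, or it is composed of several copies.\<close>
  proof (cases "\<forall>z\<in>cls a. \<exists>c. z = c @ [x] \<and> (b, c) \<in> R")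
    case True
    then have "cls a \<subseteq> (\<lambda>c. c @ [x]) ` cls b" by auto
    then have "card (cls a) \<le> card (cls b)" using bx by (intro surj_card_le) auto
    also have "\<dots> \<le> D ^ (K - card V)"
    proof (rule Suc.IH)
      fix \<nu> assume "\<nu> \<in> V"
      then obtain j e u where "e \<in> ends j" "u \<in> lists X" "j = Suc n + length u" "\<nu> = mark j e"
        "(a @ u, ep e) \<in> R" using Suc.prems by metis
      then show "\<exists>j e u. e \<in> ends j \<and> u \<in> lists X \<and> j = n + length u \<and> \<nu> = mark j e \<and> (b @ u, ep e) \<in> R"
        using a bx by (intro exI[of _ j] exI[of _ e] exI[of _ "x # u"]) simp
    qed (use a bx Suc.prems in auto)
    finally show ?thesis .
  next
    case False
    then obtain z0 where z0: "(a, z0) \<in> R" "\<not> (\<exists>c. z0 = c @ [x] \<and> (b, c) \<in> R)" by auto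
    \<comment> \<open>By \<open>R_append_isolated\<close> a piece that is not a mere copy comes from
      one containing an end.\<close>
    have "\<exists>e\<in>ends n. (b, ep e) \<in> R"
      using R_append_isolated[of b "[x]" z0] z0 a by blast
    then obtain e0 where e0: "e0 \<in> ends n" "(b, ep e0) \<in> R" by blast
    have a_e0: "(a, ep e0 @ [x]) \<in> R" using R_append[OF e0(2), of "[x]"] a bx by simp
    \<comment> \<open>Pairs of an end and a letter whose extension lies in the piece of
      \<open>a\<close>. Copies of the pieces of these ends cover it, and there are at most
      \<open>2 * M * d\<close> pairs, whence the factor \<open>D\<close>.\<close>
    define F where "F = {(f, y). f \<in> ends n \<and> y \<in> X \<and> (a, ep f @ [y]) \<in> R}"
    have F: "\<exists>(f, y)\<in>F. z \<in> (\<lambda>c. c @ [y]) ` cls (ep f)" if "(a, z) \<in> R" for z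
    proof -
      have "(ep e0 @ [x], z) \<in> R" using a_e0 that R_sym R_trans by meson
      from H_complete[OF e0(1) _ this] bx obtain c f w where
        z: "z = c @ w" "length c = n" "f \<in> ends n" "w \<in> lists X" "(c, ep f) \<in> R" by auto
      have "length z = Suc n" using R_in[OF that] Suc.prems by simp
      then obtain y where w: "w = [y]" "y \<in> X" using z by (auto simp: length_Suc_conv)
      have "(a, ep f @ [y]) \<in> R" using R_trans[OF that] R_append[OF z(5,4)] z w by simp
      then have "(f, y) \<in> F" using z w by (simp add: F_def)
      moreover have "z \<in> (\<lambda>c. c @ [y]) ` cls (ep f)" using z w R_sym by auto
      ultimately show ?thesis by blast
    qed
    have F_sub: "F \<subseteq> ends n \<times> X" by (auto simp: F_def)
    then have fin: "finite F" using finite_subset by (metis finite_SigmaI finite_X finite_ends)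
    have "card F \<le> card (ends n \<times> X)" using F_sub by (intro card_mono) auto
    also have "\<dots> \<le> 2 * M * d" using card_ends[of n] by (simp add: card_cartesian_product d_def)
    finally have cF: "card F \<le> 2 * M * d" .
    \<comment> \<open>If all pairs agreed with \<open>(f, y)\<close> up to \<open>R\<close>, the
      piece of \<open>a\<close> would be a single copy, contrary to the choice of
      \<open>z0\<close>.\<close>
    have sibling: "\<exists>(g, y')\<in>F. \<not> (y' = y \<and> (ep f, ep g) \<in> R)" if "(f, y) \<in> F" for f y
    proof (rule ccontr)
      assume "\<not> ?thesis"
      then have all: "\<And>g y'. (g, y') \<in> F \<Longrightarrow> y' = y \<and> (ep f, ep g) \<in> R" by auto
      have *: "\<exists>c. z = c @ [y] \<and> (ep f, c) \<in> R" if "(a, z) \<in> R" for z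
      proof -
        from F[OF that] obtain g y' c where g: "(g, y') \<in> F" "z = c @ [y']" "(ep g, c) \<in> R" by auto
        then show ?thesis using all[OF g(1)] R_trans[of "ep f" "ep g" c] by simp
      qed
      from *[OF R_refl] a have x: "y = x" "(ep f, b) \<in> R" by auto
      from *[OF z0(1)] obtain c where "z0 = c @ [y]" "(ep f, c) \<in> R" by blast
      then show False using z0(2) x R_trans[OF R_sym[OF x(2)]] by blast
    qed
    \<comment> \<open>A mark met twice gives an isomorphism to the later level \<open>j\<close>, and
      \<open>sibling\<close> shows that the piece of \<open>f\<close> has grown properly. By
      \<open>growth\<close> it would exceed \<open>Q\<close>.\<close>
    have fresh: "mark n f \<notin> V" if fy: "(f, y) \<in> F" for f y
    proof
      assume "mark n f \<in> V"
      then obtain j e u where e: "e \<in> ends j" "u \<in> lists X" "j = Suc n + length u"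
        "mark n f = mark j e" "(a @ u, ep e) \<in> R" using Suc.prems(4) by blast
      have f: "f \<in> ends n" "y \<in> X" "(a, ep f @ [y]) \<in> R" using fy by (auto simp: F_def)
      from mark_iso[OF e(4) f(1) e(1)] obtain \<phi> where \<phi>: "iso n j \<phi>" "apfst \<phi> f = e" by blast
      obtain g y' where g: "(g, y') \<in> F" "\<not> (y' = y \<and> (ep f, ep g) \<in> R)" using sibling[OF fy] by auto
      have g': "g \<in> ends n" "(a, ep g @ [y']) \<in> R" using g by (auto simp: F_def)
      have f_a: "(ep f @ y # u, a @ u) \<in> R"
        using R_append[OF R_sym[OF f(3)] e(2)] by simp
      have "\<exists>l \<psi>. iso n l \<psi> \<and> Q < card (cls (ep (apfst \<psi> f)))"
      proof (rule growth)
        show "iso n (n + Suc (length u)) \<phi>" using \<phi> e by simp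
        show "(ep f @ y # u, ep (apfst \<phi> f)) \<in> R" using R_trans[OF f_a] e \<phi> by simp
        show "(ep f @ y # u, ep g @ y' # u) \<in> R"
          using R_trans[OF f_a] R_append[OF g'(2) e(2)] by simp
      qed (use f e g g' in auto)
      then show False using bnd ep_in iso_ends f(1) by (metis not_le)
    qed
    have V: "finite V" using Suc.prems finite_marks finite_subset by blast
    have step: "card ((\<lambda>c. c @ [y]) ` cls (ep f)) \<le> D ^ (K - Suc (card V))" if fy: "(f, y) \<in> F" for f y
    proof -
      have f: "f \<in> ends n" "y \<in> X" "(a, ep f @ [y]) \<in> R" using fy by (auto simp: F_def)
      have "card (cls (ep f)) \<le> D ^ (K - card (insert (mark n f) V))"
      proof (rule Suc.IH)
        show "insert (mark n f) V \<subseteq> marks" using mark_in[OF f(1)] Suc.prems by simp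
        fix \<nu> assume "\<nu> \<in> insert (mark n f) V"
        then show "\<exists>j e u. e \<in> ends j \<and> u \<in> lists X \<and> j = n + length u \<and> \<nu> = mark j e \<and> (ep f @ u, ep e) \<in> R"
        proof
          assume "\<nu> = mark n f"
          then show ?thesis using f by (intro exI[of _ n] exI[of _ f] exI[of _ "[]"]) simp
        next
          assume "\<nu> \<in> V"
          then obtain j e u where e: "e \<in> ends j" "u \<in> lists X" "j = Suc n + length u"
            "\<nu> = mark j e" "(a @ u, ep e) \<in> R" using Suc.prems(4) by blast
          have "(ep f @ y # u, ep e) \<in> R"
            using R_trans[OF _ e(5)] R_append[OF R_sym[OF f(3)] e(2)] by simp
          then show ?thesis using e f by (intro exI[of _ j] exI[of _ e] exI[of _ "y # u"]) simp
        qed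
      qed (use ep_in[OF f(1)] in auto)
      moreover have "card ((\<lambda>c. c @ [y]) ` cls (ep f)) = card (cls (ep f))"
        by (simp add: card_image inj_on_def)
      ultimately show ?thesis using fresh[OF fy] V by simp
    qed
    have "insert (mark n e0) V \<subseteq> marks" using mark_in[OF e0(1)] Suc.prems by simp
    then have "card (insert (mark n e0) V) \<le> K"
      using card_mono[OF finite_marks] card_marks by metis
    \<comment> \<open>Since this mark is new as well, \<open>V\<close> does not exhaust
      \<open>marks\<close> and the exponent really drops by one.\<close>
    moreover have "mark n e0 \<notin> V" using fresh[of e0 x] e0 a_e0 bx by (simp add: F_def)
    ultimately have cV: "card V < K" using V by simp
    have "cls a \<subseteq> (\<Union>(f, y)\<in>F. (\<lambda>c. c @ [y]) ` cls (ep f))" using F by fastforce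
    then have "card (cls a) \<le> card (\<Union>(f, y)\<in>F. (\<lambda>c. c @ [y]) ` cls (ep f))"
      using fin ep_in by (intro card_mono) (auto simp: F_def)
    also have "\<dots> \<le> (\<Sum>(f, y)\<in>F. card ((\<lambda>c. c @ [y]) ` cls (ep f)))"
      using card_UN_le[OF fin, of "\<lambda>(f, y). (\<lambda>c. c @ [y]) ` cls (ep f)"] by (simp add: case_prod_beta')
    also have "\<dots> \<le> card F * D ^ (K - Suc (card V))"
      using sum_bounded_above[of F "\<lambda>(f, y). card ((\<lambda>c. c @ [y]) ` cls (ep f))"
          "D ^ (K - Suc (card V))"] step by auto
    also have "\<dots> \<le> D * D ^ (K - Suc (card V))" using cF by (intro mult_right_mono) (auto simp: D_def)
    also have "\<dots> = D ^ (K - card V)" using cV by (metis Suc_diff_Suc power_Suc)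
    finally show ?thesis .
  qed
qed

text \<open>The number \<open>Q\<close> enters only the contradiction with \<open>growth\<close>, so
  any bound at all entails this explicit one.\<close>

theorem card_cls:
  assumes "\<And>v. v \<in> lists X \<Longrightarrow> card (cls v) \<le> Q" and "v \<in> lists X"
  shows "card (cls v) \<le> D ^ K"
  using card_cls_aux[of Q v "length v" "{}"] assms by simp

section \<open>Persistence of a size bound on all levels\<close>

lemma card_cls_iso_le:
  assumes iso: "iso n n' \<phi>" and le: "\<And>e. e \<in> ends n \<Longrightarrow> card (cls (ep e)) \<le> card (cls (ep (apfst \<phi> e)))"
    and e: "e \<in> ends n" and u: "u \<in> lists X"
  shows "card (cls (ep e @ u)) \<le> card (cls (ep (apfst \<phi> e) @ u))"
proof -
  \<comment> \<open>Every piece \<open>c\<close> of level \<open>n\<close> containing an end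
    receives a representative end and, by \<open>le\<close>, an injection \<open>\<beta> c\<close>
    into the piece of its image.\<close>
  define rep where "rep c = (SOME f. f \<in> ends n \<and> ep f \<in> c)" for c
  define \<beta> where "\<beta> c = (SOME g. g ` c \<subseteq> cls (ep (apfst \<phi> (rep c))) \<and> inj_on g c)" for c
  have rep: "rep (cls a) \<in> ends n \<and> (a, ep (rep (cls a))) \<in> R" if "f \<in> ends n" "(a, ep f) \<in> R" for a f
    using someI[of "\<lambda>f. f \<in> ends n \<and> ep f \<in> cls a" f] that by (simp add: rep_def)
  have \<beta>: "\<beta> (cls a) ` cls a \<subseteq> cls (ep (apfst \<phi> (rep (cls a)))) \<and> inj_on (\<beta> (cls a)) (cls a)"
    if "f \<in> ends n" "(a, ep f) \<in> R" for a f
  proof -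
    note r = rep[OF that]
    have "cls a = cls (ep (rep (cls a)))" using r by (simp add: cls_eq)
    then have "card (cls a) \<le> card (cls (ep (apfst \<phi> (rep (cls a)))))"
      using le[of "rep (cls a)"] r by simp
    moreover have "finite (cls a)" "finite (cls (ep (apfst \<phi> (rep (cls a)))))"
      using ep_in[of "rep (cls a)" n] ep_in[OF iso_ends[OF iso]] r R_in by (auto intro!: finite_cls)
    ultimately show ?thesis using someI_ex[OF card_le_inj] unfolding \<beta>_def by blast
  qed
  \<comment> \<open>The injections are applied to prefixes, and suffixes are kept. The result is
    injective because \<open>\<phi>\<close> reflects \<open>R\<close>: distinct pieces have disjoint
    targets.\<close>
  define \<Phi> where "\<Phi> z = \<beta> (cls (take n z)) (take n z) @ drop n z" for z
  have z: "\<exists>b f w. z = b @ w \<and> length b = n \<and> f \<in> ends n \<and> w \<in> lists X \<and> (b, ep f) \<in> R \<and>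
      (ep (apfst \<phi> e) @ u, ep (apfst \<phi> f) @ w) \<in> R" if "z \<in> cls (ep e @ u)" for z
  proof -
    have "(ep e @ u, z) \<in> R" using that by simp
    from H_complete[OF e u this] obtain b f w where *: "z = b @ w" "length b = n" "f \<in> ends n"
      "w \<in> lists X" "(b, ep f) \<in> R" "((e, u), (f, w)) \<in> H n" by blast
    then have "(ep (apfst \<phi> e) @ u, ep (apfst \<phi> f) @ w) \<in> R"
      using iso_R[OF iso e _ u] H_iff_R[OF e _ u] by blast
    then show ?thesis using * by blast
  qed
  show ?thesis
  proof (rule card_inj_on_le)
    show "finite (cls (ep (apfst \<phi> e) @ u))" using ep_in[OF iso_ends[OF iso e]] u by simp
    show "\<Phi> ` cls (ep e @ u) \<subseteq> cls (ep (apfst \<phi> e) @ u)"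
    proof
      fix y assume "y \<in> \<Phi> ` cls (ep e @ u)"
      then obtain zz where zz: "zz \<in> cls (ep e @ u)" "y = \<Phi> zz" by blast
      from z[OF zz(1)] obtain b f w where *: "zz = b @ w" "length b = n" "f \<in> ends n"
        "w \<in> lists X" "(b, ep f) \<in> R" "(ep (apfst \<phi> e) @ u, ep (apfst \<phi> f) @ w) \<in> R" by blast
      let ?r = "rep (cls b)"
      have r: "?r \<in> ends n" "(ep f, ep ?r) \<in> R"
        using rep[OF *(3,5)] R_trans[OF R_sym[OF *(5)]] by auto
      then have "(ep (apfst \<phi> f), ep (apfst \<phi> ?r)) \<in> R" using iso *(3) unfolding iso_def by blast
      moreover have "(ep (apfst \<phi> ?r), \<beta> (cls b) b) \<in> R"
        using conjunct1[OF \<beta>[OF *(3,5)]] by (auto simp: image_subset_iff)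
      ultimately have "(ep (apfst \<phi> f), \<beta> (cls b) b) \<in> R" by (rule R_trans)
      then show "y \<in> cls (ep (apfst \<phi> e) @ u)"
        using R_trans[OF *(6) R_append] *(1,2,4) zz(2) by (simp add: \<Phi>_def)
    qed
    show "inj_on \<Phi> (cls (ep e @ u))"
    proof (rule inj_onI)
      fix z1 z2 assume z12: "z1 \<in> cls (ep e @ u)" "z2 \<in> cls (ep e @ u)" "\<Phi> z1 = \<Phi> z2"
      from z[OF z12(1)] obtain b1 f1 w1 where 1: "z1 = b1 @ w1" "length b1 = n" "f1 \<in> ends n"
        "(b1, ep f1) \<in> R" by blast
      from z[OF z12(2)] obtain b2 f2 w2 where 2: "z2 = b2 @ w2" "length b2 = n" "f2 \<in> ends n"
        "(b2, ep f2) \<in> R" by blast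
      note r1 = rep[OF 1(3,4)] and r2 = rep[OF 2(3,4)]
      have m1: "(ep (apfst \<phi> (rep (cls b1))), \<beta> (cls b1) b1) \<in> R"
        using conjunct1[OF \<beta>[OF 1(3,4)]] by (auto simp: image_subset_iff)
      have m2: "(ep (apfst \<phi> (rep (cls b2))), \<beta> (cls b2) b2) \<in> R"
        using conjunct1[OF \<beta>[OF 2(3,4)]] by (auto simp: image_subset_iff)
      have "length (\<beta> (cls b1) b1) = n'" "length (\<beta> (cls b2) b2) = n'"
        using R_in[OF m1] R_in[OF m2] ep_in[OF iso_ends[OF iso]] r1 r2 by auto
      then have eq: "\<beta> (cls b1) b1 = \<beta> (cls b2) b2" "w1 = w2"
        using z12(3) 1 2 by (auto simp: \<Phi>_def)
      have "(ep (apfst \<phi> (rep (cls b1))), ep (apfst \<phi> (rep (cls b2)))) \<in> R"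
        using R_trans[OF m1] R_sym[OF m2] eq(1) by simp
      then have "(ep (rep (cls b1)), ep (rep (cls b2))) \<in> R"
        using iso r1 r2 unfolding iso_def by blast
      then have "(b1, b2) \<in> R" using r1 r2 R_trans R_sym by meson
      then have c: "cls b1 = cls b2" by (rule cls_eq)
      have "b1 = b2"
        by (rule inj_onD[OF conjunct2[OF \<beta>[OF 1(3,4)]]]) (use eq c \<open>(b1, b2) \<in> R\<close> in auto)
      then show "z1 = z2" using 1 2 eq by simp
    qed
  qed
qed

text \<open>Bounds the number of pairs of a code and a table of piece sizes at most
  \<open>Q\<close>, the table being a subset of a set with \<open>2 * M * Suc Q\<close>
  elements.\<close>

definition L :: "nat \<Rightarrow> nat" where
  "L Q = 2 ^ (M * m) * 2 ^ (2 * M * (2 * M)) * 2 ^ (2 * M * Suc Q)"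

text \<open>Two levels \<open>n < n'\<close> up to \<open>L Q\<close> agree in code and sizes. In a
  longer word whose prefix of length \<open>n'\<close> lies in a piece with an end, that prefix is
  replaced by an end of level \<open>n\<close>; by \<open>card_cls_iso_le\<close> the piece does not
  shrink, and the word is shorter.\<close>

theorem card_cls_all_levels:
  assumes small: "\<And>v. v \<in> lists X \<Longrightarrow> length v \<le> L Q \<Longrightarrow> card (cls v) \<le> Q" and v: "v \<in> lists X"
  shows "card (cls v) \<le> Q"
proof -
  define sizes where
    "sizes n = {(a, q). fst a < card (ports n) \<and> q = card (cls (ep (apfst (enum n) a)))}" for n
  let ?C = "codes \<times> Pow (({..<M} \<times> (UNIV :: bool set)) \<times> {..Q})"
  \<comment> \<open>Pigeonhole: there are \<open>L Q + 1\<close> levels up to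
    \<open>L Q\<close>.\<close>
  have "\<not> inj_on (\<lambda>n. (code n, sizes n)) {..L Q}"
  proof
    assume "inj_on (\<lambda>n. (code n, sizes n)) {..L Q}"
    moreover have "(\<lambda>n. (code n, sizes n)) ` {..L Q} \<subseteq> ?C"
    proof (rule image_subsetI)
      fix n assume "n \<in> {..L Q}"
      then have n: "n \<le> L Q" by simp
      have "sizes n \<subseteq> ({..<M} \<times> UNIV) \<times> {..Q}"
      proof
        fix t assume "t \<in> sizes n"
        then obtain i c q where t: "t = ((i, c), q)" "i < card (ports n)"
          "q = card (cls (ep (enum n i, c)))"
          unfolding sizes_def by (cases t) (auto simp: apfst_def)
        note i = t(2,3)
        have "(enum n i, c) \<in> ends n" using enum_port[OF i(1)] by (simp add: ends_def)
        from ep_in[OF this] have "q \<le> Q" using small n i by simp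
        then show "t \<in> ({..<M} \<times> UNIV) \<times> {..Q}" using t card_ports[of n] by auto
      qed
      then show "(code n, sizes n) \<in> ?C" using code_in by simp
    qed
    moreover have "finite ?C" using finite_codes by simp
    ultimately have "card {..L Q} \<le> card ?C" by (rule card_inj_on_le)
    also have "card ?C = L Q"
      by (simp add: card_cartesian_product card_codes card_Pow L_def algebra_simps)
    finally show False by simp
  qed
  then obtain n n' where nn': "n < n'" "n' \<le> L Q" "code n' = code n" "sizes n' = sizes n"
    unfolding inj_on_def by (metis atMost_iff linorder_neqE_nat prod.inject)
  from code_iso[OF nn'(3)] obtain \<phi> where \<phi>: "iso n' n \<phi>" "card (ports n') = card (ports n)"
    "\<And>i. i < card (ports n') \<Longrightarrow> \<phi> (enum n' i) = enum n i" by blast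
  have le: "card (cls (ep e)) \<le> card (cls (ep (apfst \<phi> e)))" if "e \<in> ends n'" for e
  proof -
    let ?i = "inv_into {..<card (ports n')} (enum n') (fst e)"
    have i: "?i < card (ports n')" "enum n' ?i = fst e"
      using that inv_enum[of "fst e" n'] by (auto simp: ends_def)
    have "apfst (enum n') (?i, snd e) = e" "apfst (enum n) (?i, snd e) = apfst \<phi> e"
      using i \<phi>(3)[OF i(1)] by (cases e; simp)+
    then have "((?i, snd e), card (cls (ep e))) \<in> sizes n'" using i by (simp add: sizes_def)
    then have "((?i, snd e), card (cls (ep e))) \<in> sizes n" using nn' by simp
    then show ?thesis using \<open>apfst (enum n) (?i, snd e) = apfst \<phi> e\<close> by (auto simp: sizes_def)
  qed
  show ?thesis using v
  proof (induction "length v" arbitrary: v rule: less_induct)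
    case less
    show ?case
    proof (cases "length v \<le> L Q")
      case False
      define a u where "a = take n' v" and "u = drop n' v"
      have au: "v = a @ u" "length a = n'" using False nn' by (auto simp: a_def u_def)
      then have in_X: "a \<in> lists X" "u \<in> lists X" using less.prems by auto
      show ?thesis
      proof (cases "\<exists>e\<in>ends n'. (a, ep e) \<in> R")
        case True
        then obtain e where e: "e \<in> ends n'" "(a, ep e) \<in> R" by blast
        have "cls v = cls (ep e @ u)" using au R_append[OF e(2) in_X(2)] by (simp add: cls_eq)
        then have "card (cls v) \<le> card (cls (ep (apfst \<phi> e) @ u))"
          using card_cls_iso_le[OF \<phi>(1) le e(1) in_X(2)] by simp
        also have "\<dots> \<le> Q"
          using ep_in[OF iso_ends[OF \<phi>(1) e(1)]] au nn' in_X by (intro less.hyps) auto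
        finally show ?thesis .
      next
        case False
        then have "cls v = (\<lambda>b. b @ u) ` cls a"
          using cls_append_isolated[of a u] au in_X by auto
        also have "card \<dots> \<le> card (cls a)" using in_X by (intro card_image_le) simp
        also have "\<dots> \<le> Q" using small in_X au nn' by simp
        finally show ?thesis .
      qed
    qed (use small less.prems in blast)
  qed
qed

end

section \<open>Orbits and finiteness of the group\<close>

context bounded_aut
begin

definition edges :: "('x list \<times> 'x list) set" where
  "edges = {(v, act s v) | s v. s \<in> S \<and> v \<in> lists X}"

text \<open>The component of \<open>v\<close> in the Schreier graph of the generators, that is its
  orbit under the group.\<close>

definition orb :: "'x list \<Rightarrow> 'x list set" where
  "orb v = ((edges \<union> edges\<inverse>)\<^sup>*) `` {v}"

lemma orb_refl [simp]: "v \<in> orb v"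
  by (simp add: orb_def)

lemma orb_step: "w \<in> orb v \<Longrightarrow> (w, w') \<in> edges \<or> (w', w) \<in> edges \<Longrightarrow> w' \<in> orb v"
  unfolding orb_def by (auto intro: rtrancl_into_rtrancl)

lemma orb_induct [consumes 1, case_names refl step]:
  assumes "w \<in> orb v" "P v"
    and "\<And>w w'. w \<in> orb v \<Longrightarrow> P w \<Longrightarrow> (w, w') \<in> edges \<or> (w', w) \<in> edges \<Longrightarrow> P w'"
  shows "P w"
proof -
  have "(v, w) \<in> (edges \<union> edges\<inverse>)\<^sup>*" using assms(1) by (simp add: orb_def)
  then show ?thesis
    by (induction rule: rtrancl_induct) (use assms(2,3) in \<open>auto simp: orb_def\<close>)
qed

lemma orb_sym: "w \<in> orb v \<Longrightarrow> v \<in> orb w"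
proof -
  have "sym ((edges \<union> edges\<inverse>)\<^sup>*)" by (rule sym_rtrancl) (auto simp: sym_def)
  then show "w \<in> orb v \<Longrightarrow> v \<in> orb w" by (simp add: orb_def sym_def)
qed

lemma orb_eq: "w \<in> orb v \<Longrightarrow> orb w = orb v"
  using orb_sym[of w v] unfolding orb_def by (auto intro: rtrancl_trans)

lemma edges_in: "(v, w) \<in> edges \<Longrightarrow> v \<in> lists X \<and> w \<in> lists X \<and> length v = length w"
  by (auto simp: edges_def act_in)

lemma orb_in: "w \<in> orb v \<Longrightarrow> v \<in> lists X \<Longrightarrow> w \<in> lists X \<and> length w = length v"
  by (induction rule: orb_induct) (auto dest: edges_in)

lemma finite_orb [simp]: "v \<in> lists X \<Longrightarrow> finite (orb v)"
proof (rule finite_subset[OF _ finite_length[of "length v"]])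
  show "v \<in> lists X \<Longrightarrow> orb v \<subseteq> {w \<in> lists X. length w = length v}"
    by (intro subsetI CollectI) (rule orb_in)
qed

lemma act_orb: "s \<in> S \<Longrightarrow> v \<in> lists X \<Longrightarrow> act s v \<in> orb v"
  by (rule orb_step[OF orb_refl]) (auto simp: edges_def)

lemma cls_subset_orb: "cls v \<subseteq> orb v"
proof
  fix w assume "w \<in> cls v"
  then have "(v, w) \<in> R" by simp
  then show "w \<in> orb v"
  proof (induction rule: R_induct)
    case (step w w')
    have "T \<subseteq> edges" by (auto simp: T_def edges_def)
    then show ?case using orb_step step by blast
  qed simp
qed

text \<open>A step with trivial section stays within its piece, and any other step arrives at an
  end. Hence the orbit is covered by the piece of \<open>v\<close> and those of at most
  \<open>2 * M\<close> ends.\<close>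

lemma card_orb:
  assumes Q: "\<And>v. v \<in> lists X \<Longrightarrow> card (cls v) \<le> Q" and v: "v \<in> lists X"
  shows "card (orb v) \<le> (2 * M + 1) * Q"
proof -
  let ?n = "length v"
  let ?U = "cls v \<union> (\<Union>e\<in>ends ?n. cls (ep e))"
  have closed: "w' \<in> ?U" if "w \<in> ?U" "(w, w') \<in> R" for w w'
    using that R_trans[OF _ that(2)] by auto
  have "orb v \<subseteq> ?U"
  proof
    fix w assume "w \<in> orb v"
    then show "w \<in> ?U"
    proof (induction rule: orb_induct)
      case (step w w')
      have len: "w \<in> lists X" "length w = ?n" using orb_in[OF step.hyps(1) v] by auto
      from step.hyps(2) show ?case
      proof
        assume "(w, w') \<in> edges"
        then obtain s where s: "s \<in> S" "w' = act s w" by (auto simp: edges_def)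
        show ?thesis
        proof (cases "triv (sec s w)")
          case True
          then have "(w, w') \<in> T" using s len by (auto simp: T_def)
          then show ?thesis using closed step.IH T_R by blast
        next
          case False
          then have "((s, w), True) \<in> ends ?n" using s len by (simp add: ends_def ports_def live_def)
          moreover have "w' \<in> cls (ep ((s, w), True))" using s by (simp add: ep_def)
          ultimately show ?thesis by blast
        qed
      next
        assume e: "(w', w) \<in> edges"
        then obtain s where s: "s \<in> S" "w = act s w'" "w' \<in> lists X" by (auto simp: edges_def)
        show ?thesis
        proof (cases "triv (sec s w')")
          case True
          then have "(w', w) \<in> T" using s by (auto simp: T_def)
          then show ?thesis using closed[OF step.IH] T_R R_sym by blast
        next
          case False
          moreover have "length w' = ?n" using edges_in[OF e] len by simp
          ultimately have "((s, w'), False) \<in> ends ?n"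
            using s(1,3) by (simp add: ends_def ports_def live_def)
          moreover have "w' \<in> cls (ep ((s, w'), False))" by (simp add: ep_def)
          ultimately show ?thesis by blast
        qed
      qed
    qed simp
  qed
  moreover have "finite ?U" using v ep_in by auto
  ultimately have "card (orb v) \<le> card ?U" by (rule card_mono[rotated])
  also have "\<dots> \<le> card (cls v) + card (\<Union>e\<in>ends ?n. cls (ep e))" by (rule card_Un_le)
  also have "card (\<Union>e\<in>ends ?n. cls (ep e)) \<le> (\<Sum>e\<in>ends ?n. card (cls (ep e)))"
    by (rule card_UN_le) simp
  also have "\<dots> \<le> card (ends ?n) * Q"
    using sum_bounded_above[of "ends ?n" "\<lambda>e. card (cls (ep e))" Q] Q ep_in by auto
  also have "\<dots> \<le> 2 * M * Q" using card_ends by (intro mult_right_mono) auto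
  finally show ?thesis using Q[OF v] by (simp add: algebra_simps)
qed

section \<open>The automaton group as a permutation group on words\<close>

abbreviation G where "G \<equiv> BijGroup (lists X)"

lemma G_group: "group G" by (rule group_BijGroup)

lemma transformation_G: "s \<in> S \<Longrightarrow> transformation A s \<in> carrier G"
  using automaton_simps(3) by (simp add: invertible_automaton_def BijGroup_def)

abbreviation Gen where "Gen \<equiv> generate G (transformation A ` S)"

lemma Gen_carrier: "Gen \<subseteq> carrier G"
  using group.generate_incl[OF G_group] transformation_G by blast

lemma Gen_in: "g \<in> Gen \<Longrightarrow> v \<in> lists X \<Longrightarrow> g v \<in> lists X"
  using Gen_carrier Bij_imp_funcset[of g "lists X"] by (auto simp: BijGroup_def Pi_iff)

lemma mult_apply: "g \<in> carrier G \<Longrightarrow> h \<in> carrier G \<Longrightarrow> v \<in> lists X \<Longrightarrow> (g \<otimes>\<^bsub>G\<^esub> h) v = g (h v)"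
  by (simp add: BijGroup_def compose_def)

lemma inv_apply:
  assumes s: "s \<in> S" and v: "v \<in> lists X"
  obtains u where "u \<in> lists X" "act s u = v" "(inv\<^bsub>G\<^esub> (transformation A s)) v = u"
proof -
  have "transformation A s \<in> Bij (lists X)" using transformation_G[OF s] by (simp add: BijGroup_def)
  then have inv: "inv\<^bsub>G\<^esub> (transformation A s) = (\<lambda>x\<in>lists X. inv_into (lists X) (transformation A s) x)"
    by (rule inv_BijGroup)
  have "v \<in> act s ` lists X" using bij_act[OF s] v by (simp add: bij_betw_def)
  then obtain u where u: "u \<in> lists X" "act s u = v" by (metis imageE)
  have "inj_on (transformation A s) (lists X)"
    using transformation_G[OF s] by (simp add: BijGroup_def Bij_def bij_betw_def)
  moreover have "transformation A s u = v" using u by (simp add: transformation_def)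
  ultimately have "inv_into (lists X) (transformation A s) v = u" using u(1) inv_into_f_f by fastforce
  then show thesis using that[OF u] v inv by simp
qed

lemma orb_Gen: "w \<in> orb v \<Longrightarrow> v \<in> lists X \<Longrightarrow> \<exists>g\<in>Gen. g v = w"
proof (induction rule: orb_induct)
  case refl
  have "\<one>\<^bsub>G\<^esub> \<in> Gen" by (rule generate.one)
  moreover have "\<one>\<^bsub>G\<^esub> v = v" using refl by (simp add: BijGroup_def)
  ultimately show ?case by blast
next
  case (step w w')
  obtain g where g: "g \<in> Gen" "g v = w" using step by blast
  have w: "w \<in> lists X" using orb_in[OF step.hyps(1)] step.prems by simp
  from step.hyps(2) show ?case
  proof
    assume "(w, w') \<in> edges"
    then obtain s where s: "s \<in> S" "w' = act s w" by (auto simp: edges_def)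
    let ?h = "transformation A s"
    have "?h \<in> Gen" using s by (auto intro: generate.incl)
    then have "?h \<otimes>\<^bsub>G\<^esub> g \<in> Gen" using g by (intro generate.eng)
    moreover have "(?h \<otimes>\<^bsub>G\<^esub> g) v = w'"
      using mult_apply[OF transformation_G[OF s(1)] _ step.prems] g Gen_carrier s w
      by (auto simp: transformation_def)
    ultimately show ?thesis by blast
  next
    assume "(w', w) \<in> edges"
    then obtain s where s: "s \<in> S" "w = act s w'" "w' \<in> lists X" by (auto simp: edges_def)
    let ?h = "inv\<^bsub>G\<^esub> (transformation A s)"
    from inv_apply[OF s(1) w] obtain u where u: "u \<in> lists X" "act s u = w" "?h w = u" by blast
    have "u = w'" using bij_act[OF s(1)] u s by (auto simp: bij_betw_def inj_on_def)
    have "?h \<in> Gen" using s by (auto intro: generate.inv)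
    then have "?h \<otimes>\<^bsub>G\<^esub> g \<in> Gen" using g by (intro generate.eng)
    moreover have "(?h \<otimes>\<^bsub>G\<^esub> g) v = w'"
      using mult_apply[OF _ _ step.prems, of ?h g] g Gen_carrier \<open>?h \<in> Gen\<close> u \<open>u = w'\<close> by auto
    ultimately show ?thesis by blast
  qed
qed

lemma finite_Gen_orb:
  assumes "finite Gen" "v \<in> lists X"
  shows "card (orb v) \<le> card Gen"
proof -
  have "orb v \<subseteq> (\<lambda>g. g v) ` Gen" using orb_Gen[OF _ assms(2)] by blast
  then show ?thesis using assms(1) by (rule surj_card_le[rotated])
qed

text \<open>Number the elements of each orbit by \<open>{..<Q}\<close>. The type of \<open>v\<close> consists of its number
  and of the tables of the generators on its orbit. An element of the group acts on types, and
  is determined by this action.\<close>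

lemma bounded_orb_finite_Gen:
  assumes Q: "\<And>v. v \<in> lists X \<Longrightarrow> card (orb v) \<le> Q"
  shows "finite Gen"
proof -
  define num where "num c = (SOME f. f ` c \<subseteq> {..<Q} \<and> inj_on f c)" for c :: "'x list set"
  have num: "num (orb v) ` orb v \<subseteq> {..<Q} \<and> inj_on (num (orb v)) (orb v)" if "v \<in> lists X" for v
    using someI_ex[OF card_le_inj[of "orb v" "{..<Q}"]] Q that by (simp add: num_def)
  have num_eq: "w = w'" if "num (orb v) w = num (orb v) w'" "w \<in> orb v" "w' \<in> orb v" "v \<in> lists X"
    for v w w'
    using num[OF that(4)] that(1-3) unfolding inj_on_def by blast
  define tab where "tab c = {(s, num c w, num c (act s w)) | s w. s \<in> S \<and> w \<in> c}" for c
  define ty where "ty v = (num (orb v) v, tab (orb v))" for v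
  define Ty where "Ty = ty ` lists X"
  have "Ty \<subseteq> {..<Q} \<times> Pow (S \<times> {..<Q} \<times> {..<Q})"
  proof -
    have "ty v \<in> {..<Q} \<times> Pow (S \<times> {..<Q} \<times> {..<Q})" if v: "v \<in> lists X" for v
    proof -
      have n: "num (orb v) w < Q" if "w \<in> orb v" for w using num[OF v] that by blast
      have "act s w \<in> orb v" if "s \<in> S" "w \<in> orb v" for s w
        using act_orb[of s w] orb_eq[OF that(2)] orb_in[OF that(2) v] that(1) by simp
      then have "tab (orb v) \<subseteq> S \<times> {..<Q} \<times> {..<Q}" using n by (auto simp: tab_def)
      then show ?thesis using n by (simp add: ty_def)
    qed
    then show ?thesis unfolding Ty_def by blast
  qed
  then have "finite Ty" by (rule finite_subset) simp
  have Gen: "(\<forall>v\<in>lists X. g v \<in> orb v) \<and>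
      (\<forall>v\<in>lists X. \<forall>v'\<in>lists X. ty v = ty v' \<longrightarrow> ty (g v) = ty (g v'))" if "g \<in> Gen" for g
    using that
  proof (induction rule: generate.induct)
    case one
    then show ?case by (simp add: BijGroup_def)
  next
    case (incl h)
    then obtain s where s: "s \<in> S" "h = transformation A s" by blast
    then have h: "h v = act s v" if "v \<in> lists X" for v using that by (simp add: transformation_def)
    have "ty (h v) = ty (h v')" if v: "v \<in> lists X" "v' \<in> lists X" "ty v = ty v'" for v v'
    proof -
      have "(s, num (orb v) v, num (orb v) (act s v)) \<in> tab (orb v)"
        using s by (auto simp: tab_def)
      also have "tab (orb v) = tab (orb v')" using v by (simp add: ty_def)
      finally obtain w where w: "w \<in> orb v'" "num (orb v') w = num (orb v) v"
        "num (orb v') (act s w) = num (orb v) (act s v)" by (auto simp: tab_def)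
      then have "w = v'" using num_eq[of v' w v'] v by (simp add: ty_def)
      then show ?thesis
        using w v orb_eq[OF act_orb[OF s(1)]] by (simp add: h ty_def)
    qed
    moreover have "h v \<in> orb v" if "v \<in> lists X" for v using h act_orb[OF s(1)] that by simp
    ultimately show ?case by blast
  next
    case (inv h)
    then obtain s where s: "s \<in> S" "h = transformation A s" by blast
    let ?h = "inv\<^bsub>G\<^esub> h"
    have h: "?h v \<in> lists X \<and> act s (?h v) = v \<and> ?h v \<in> orb v" if v: "v \<in> lists X" for v
    proof -
      from inv_apply[OF s(1) v] obtain u where "u \<in> lists X" "act s u = v" "?h v = u"
        using s(2) by blast
      then show ?thesis using act_orb[OF s(1), of u] orb_sym by simp
    qed
    have "ty (?h v) = ty (?h v')" if v: "v \<in> lists X" "v' \<in> lists X" "ty v = ty v'" for v v'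
    proof -
      \<comment> \<open>For the inverse the table is read backwards: its entry locates the preimage
        of \<open>v'\<close> in \<open>orb v'\<close> by number.\<close>
      have "(s, num (orb v) (?h v), num (orb v) (act s (?h v))) \<in> tab (orb v)"
        using s h[OF v(1)] unfolding tab_def by blast
      also have "tab (orb v) = tab (orb v')" using v by (simp add: ty_def)
      finally obtain w where w: "w \<in> orb v'" "num (orb v') w = num (orb v) (?h v)"
        "num (orb v') (act s w) = num (orb v') v'"
        using h[OF v(1)] v(3) by (auto simp: tab_def ty_def)
      have w_in: "w \<in> lists X" using orb_in[OF w(1) v(2)] by simp
      have "act s w \<in> orb v'" using act_orb[OF s(1) w_in] orb_eq[OF w(1)] by simp
      then have "act s w = v'" using num_eq[OF w(3)] v by simp
      then have "w = ?h v'"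
        using bij_act[OF s(1)] h[OF v(2)] w_in by (auto simp: bij_betw_def inj_on_def)
      moreover have "orb (?h v) = orb v" "orb (?h v') = orb v'" using h v orb_eq by blast+
      ultimately show ?thesis using w v by (simp add: ty_def)
    qed
    then show ?case using h by blast
  next
    case (eng g h)
    have gh: "(g \<otimes>\<^bsub>G\<^esub> h) v = g (h v)" if "v \<in> lists X" for v
      using that eng.hyps Gen_carrier by (intro mult_apply) auto
    have hv: "h v \<in> lists X" if "v \<in> lists X" for v using that eng.hyps Gen_in by blast
    have "g (h v) \<in> orb v" if "v \<in> lists X" for v
      using eng.IH hv[OF that] that orb_eq[of "h v" v] by blast
    then have "(g \<otimes>\<^bsub>G\<^esub> h) v \<in> orb v" if "v \<in> lists X" for v using gh that by simp
    moreover have "ty (g (h v)) = ty (g (h v'))"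
      if "v \<in> lists X" "v' \<in> lists X" "ty v = ty v'" for v v'
      using eng.IH hv that by blast
    then have "ty ((g \<otimes>\<^bsub>G\<^esub> h) v) = ty ((g \<otimes>\<^bsub>G\<^esub> h) v')"
      if "v \<in> lists X" "v' \<in> lists X" "ty v = ty v'" for v v'
      unfolding gh[OF that(1)] gh[OF that(2)] using that .
    ultimately show ?case by blast
  qed
  define rep where "rep t = (SOME v. v \<in> lists X \<and> ty v = t)" for t
  have rep: "rep t \<in> lists X \<and> ty (rep t) = t" if "t \<in> Ty" for t
    using someI_ex[of "\<lambda>v. v \<in> lists X \<and> ty v = t"] that unfolding rep_def Ty_def by blast
  \<comment> \<open>By \<open>Gen\<close> the induced map on types does not depend on the
    representative \<open>rep t\<close>.\<close>
  define F where "F g = (\<lambda>t\<in>Ty. ty (g (rep t)))" for g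
  have "inj_on F Gen"
  proof (rule inj_onI)
    fix g h assume gh: "g \<in> Gen" "h \<in> Gen" "F g = F h"
    have "g v = h v" if v: "v \<in> lists X" for v
    proof -
      have t: "ty v \<in> Ty" using v by (simp add: Ty_def)
      note r = rep[OF t]
      have "ty (g v) = ty (g (rep (ty v)))" using Gen[OF gh(1)] r v by metis
      also have "\<dots> = ty (h (rep (ty v)))" using fun_cong[OF gh(3), of "ty v"] t by (simp add: F_def)
      also have "\<dots> = ty (h v)" using Gen[OF gh(2)] r v by metis
      finally have "ty (g v) = ty (h v)" .
      \<comment> \<open>Numbers are injective on a single orbit, so equal types there mean equal
        words.\<close>
      moreover have "g v \<in> orb v" "h v \<in> orb v" using Gen gh v by auto
      ultimately show ?thesis using num_eq[of v] v orb_eq by (simp add: ty_def)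
    qed
    moreover have "g \<in> extensional (lists X)" "h \<in> extensional (lists X)"
      using gh Gen_carrier Bij_imp_extensional by (auto simp: BijGroup_def)
    ultimately show "g = h" by (rule extensionalityI[rotated 2])
  qed
  moreover have "F ` Gen \<subseteq> Ty \<rightarrow>\<^sub>E Ty"
  proof (rule image_subsetI)
    fix g assume g: "g \<in> Gen"
    have "ty (g (rep t)) \<in> Ty" if "t \<in> Ty" for t
      using Gen_in[OF g] rep[OF that] unfolding Ty_def by blast
    then show "F g \<in> Ty \<rightarrow>\<^sub>E Ty" by (simp add: F_def)
  qed
  moreover have "finite (Ty \<rightarrow>\<^sub>E Ty)" using \<open>finite Ty\<close> by (intro finite_PiE)
  ultimately show ?thesis by (rule inj_on_finite)
qed

section \<open>A finite test by shortening products of states\<close>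

abbreviation acts :: "'s list \<Rightarrow> 'x list \<Rightarrow> 'x list" where
  "acts w v \<equiv> foldl (\<lambda>v s. act s v) v w"

text \<open>The word \<open>w'\<close> may depend on \<open>v\<close>: the condition bounds orbits
  rather than lengths of group elements.\<close>

definition shortening :: "nat \<Rightarrow> nat \<Rightarrow> bool" where
  "shortening N B \<longleftrightarrow> (\<forall>v\<in>lists X. length v \<le> N \<longrightarrow> (\<forall>w\<in>lists S. length w \<le> Suc B \<longrightarrow>
    (\<exists>w'\<in>lists S. length w' \<le> B \<and> acts w v = acts w' v)))"

lemma acts_orb: "w \<in> lists S \<Longrightarrow> v \<in> lists X \<Longrightarrow> acts w v \<in> orb v"
proof (induction w arbitrary: v rule: lists.induct)
  case (Cons s w)
  then show ?case using act_orb[of s v] orb_eq[of "act s v" v] orb_in[of "act s v" v] by auto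
qed simp

text \<open>The \<open>B + 1\<close> prefixes of \<open>w\<close> of length at most \<open>B\<close>
  move \<open>v\<close> within an orbit of at most \<open>B\<close> words. Two images agree, and the
  factor between them is cut out.\<close>

lemma shortening_if_card_orb:
  assumes B: "\<And>v. v \<in> lists X \<Longrightarrow> card (orb v) \<le> B"
  shows "shortening N B"
  unfolding shortening_def
proof (intro ballI impI)
  fix v w assume v: "v \<in> lists X" and w: "w \<in> lists S" "length w \<le> Suc B"
  have takes: "take i w \<in> lists S" "drop i w \<in> lists S" for i
    using w(1) append_take_drop_id[of i w] by (metis append_in_lists_conv)+
  show "\<exists>w'\<in>lists S. length w' \<le> B \<and> acts w v = acts w' v"
  proof (cases "length w \<le> B")
    case False
    have "\<not> inj_on (\<lambda>i. acts (take i w) v) {..B}"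
    proof
      assume "inj_on (\<lambda>i. acts (take i w) v) {..B}"
      then have "card {..B} \<le> card (orb v)"
        using v acts_orb takes by (intro card_inj_on_le) auto
      then show False using B[OF v] by simp
    qed
    then obtain i j where ij: "i < j" "j \<le> B" "acts (take i w) v = acts (take j w) v"
      unfolding inj_on_def by (metis atMost_iff linorder_neqE_nat)
    have "acts w v = acts (drop j w) (acts (take j w) v)"
      by (metis append_take_drop_id foldl_append)
    then have "acts w v = acts (take i w @ drop j w) v" using ij by simp
    moreover have "length (take i w @ drop j w) \<le> B" using ij w by simp
    moreover have "take i w @ drop j w \<in> lists S" using takes by simp
    ultimately show ?thesis by blast
  qed (use w in blast)
qed

text \<open>Bounds the number of words over \<open>S\<close> of length at most \<open>B\<close>. The
  base \<open>Suc m\<close> also covers \<open>m = 0\<close>, where \<open>m ^ i\<close> is not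
  increasing in \<open>i\<close>.\<close>

definition shortening_bound :: "nat \<Rightarrow> nat" where
  "shortening_bound B = Suc B * Suc m ^ B"

text \<open>Shortening closes the images of \<open>v\<close> under products of at most
  \<open>B\<close> states under all generators. Being finite, this set is also closed under their
  inverses, so it contains the orbit.\<close>

lemma card_cls_if_shortening:
  assumes sh: "shortening N B" and v: "v \<in> lists X" "length v \<le> N"
  shows "card (cls v) \<le> shortening_bound B"
proof -
  let ?W = "{w \<in> lists S. length w \<le> B}"
  let ?F = "(\<lambda>w. acts w v) ` ?W"
  have W: "finite ?W" "card ?W \<le> shortening_bound B"
  proof -
    show "finite ?W" using finite_lists_length_le[OF finite_S, of B] by (simp add: lists_eq_set)
    have "card ?W = (\<Sum>i\<le>B. m ^ i)"
      using card_lists_length_le[OF finite_S, of B] by (simp add: lists_eq_set m_def)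
    also have "\<dots> \<le> (\<Sum>i\<le>B. Suc m ^ B)"
    proof (rule sum_mono)
      fix i assume "i \<in> {..B}"
      then have "m ^ i \<le> Suc m ^ i" "Suc m ^ i \<le> Suc m ^ B"
        by (auto intro!: power_mono power_increasing)
      then show "m ^ i \<le> Suc m ^ B" by simp
    qed
    also have "\<dots> = shortening_bound B" by (simp add: shortening_bound_def)
    finally show "card ?W \<le> shortening_bound B" .
  qed
  have F_in: "z \<in> lists X" if "z \<in> ?F" for z
    using that acts_orb[OF _ v(1)] orb_in[OF _ v(1)] by blast
  have closed: "act s z \<in> ?F" if s: "s \<in> S" and z: "z \<in> ?F" for s z
  proof -
    obtain w where w: "w \<in> lists S" "length w \<le> B" "z = acts w v" using z by blast
    then have "w @ [s] \<in> lists S" "length (w @ [s]) \<le> Suc B" using s by auto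
    then obtain w' where "w' \<in> lists S" "length w' \<le> B" "acts (w @ [s]) v = acts w' v"
      using sh v unfolding shortening_def by blast
    then show ?thesis using w by auto
  qed
  have onto: "z \<in> ?F" if s: "s \<in> S" and z: "act s z \<in> ?F" "z \<in> lists X" for s z
  proof -
    have inj: "inj_on (act s) (lists X)" using bij_act[OF s] by (simp add: bij_betw_def)
    have "act s ` ?F = ?F"
      using W(1) closed[OF s] F_in by (intro endo_inj_surj inj_on_subset[OF inj]) auto
    with z(1) have "act s z \<in> act s ` ?F" by simp
    then obtain y where y: "act s z = act s y" "y \<in> ?F" by (rule imageE)
    have "z = y" by (rule inj_onD[OF inj y(1) z(2) F_in[OF y(2)]])
    then show ?thesis using y(2) by simp
  qed
  have "orb v \<subseteq> ?F"
  proof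
    fix z assume "z \<in> orb v"
    then show "z \<in> ?F"
    proof (induction rule: orb_induct)
      case refl
      show ?case by (rule image_eqI[of _ _ "[]"]) simp_all
    next
      case (step z z')
      from step.hyps(2) show ?case
        unfolding edges_def using closed[OF _ step.IH] onto[of _ z'] step.IH by blast
    qed
  qed
  then have "card (cls v) \<le> card ?F" using cls_subset_orb[of v] W(1) by (intro card_mono) auto
  also have "\<dots> \<le> card ?W" by (rule card_image_le[OF W(1)])
  finally show ?thesis using W(2) by linarith
qed

text \<open>The orbit bound of \<open>card_orb\<close> for pieces of size at most
  \<open>D ^ K\<close>.\<close>

definition word_bound :: nat where "word_bound = (2 * M + 1) * D ^ K"

definition level_bound :: nat where "level_bound = L (shortening_bound word_bound)"

text \<open>Finiteness bounds pieces, hence explicitly by \<open>card_cls\<close>, and then orbits.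
  Conversely the test bounds pieces up to \<open>level_bound\<close>, and
  \<open>card_cls_all_levels\<close> extends the bound to all levels.\<close>

theorem finite_automaton_group_iff:
  "finite (carrier (automaton_group A)) \<longleftrightarrow> shortening level_bound word_bound"
proof -
  have carrier: "carrier (automaton_group A) = Gen" by (simp add: automaton_group_def)
  show ?thesis
    unfolding carrier
  proof
    assume fin: "finite Gen"
    have "card (cls v) \<le> card Gen" if "v \<in> lists X" for v
      using card_mono[OF finite_orb[OF that] cls_subset_orb] finite_Gen_orb[OF fin that] by linarith
    then have "card (cls v) \<le> D ^ K" if "v \<in> lists X" for v using card_cls that by blast
    then have "card (orb v) \<le> word_bound" if "v \<in> lists X" for v
      unfolding word_bound_def using card_orb that by blast
    then show "shortening level_bound word_bound" by (rule shortening_if_card_orb)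
  next
    assume "shortening level_bound word_bound"
    then have "card (cls v) \<le> shortening_bound word_bound" if "v \<in> lists X" for v
      using card_cls_all_levels[of "shortening_bound word_bound"] card_cls_if_shortening that
      unfolding level_bound_def by blast
    then show "finite Gen" using bounded_orb_finite_Gen card_orb by blast
  qed
qed

end

section \<open>The decision procedure\<close>

lemma computable_length:
  fixes xs :: "nat list \<Rightarrow> 'a::coded list"
  assumes "computable k xs"
  shows "computable k (\<lambda>e. length (xs e))"
proof -
  have "length ys = foldl (\<lambda>r _. Suc r) 0 ys" for ys :: "'a list"
    by (induction ys rule: rev_induct) auto
  then show ?thesis
    by (simp only:) (intro computable_foldl computable_Suc computable_dec computable_nth
        computable_const assms, simp)
qed

definition transitions :: "(nat, nat) automaton \<Rightarrow> ((nat \<times> nat) \<times> (nat \<times> nat)) list" where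
  "transitions A = [((s, x), step A s x).
     s \<leftarrow> sorted_list_of_set (states A), x \<leftarrow> sorted_list_of_set (alphabet A)]"

lemma automaton_input_eq:
  "automaton_input A = [enc (sorted_list_of_set (alphabet A)),
    enc (sorted_list_of_set (states A)), enc (transitions A)]"
proof -
  have "enc xs = list_encode xs" for xs :: "nat list"
    by (simp add: enc_list_def map_idI)
  then show ?thesis
    by (simp add: automaton_input_def Let_def transitions_def enc_list_def[of "concat _"]
        map_concat comp_def enc_prod_def)
qed

lemma lookup_transitions:
  assumes "finite_automaton A" "s \<in> states A" "x \<in> alphabet A"
  shows "lookup (transitions A) (s, x) = step A s x"
  using assms by (intro lookup_map) (auto simp: transitions_def finite_automaton_def)

lemma (in bounded_aut) foldl_run:
  assumes "\<And>s v. s \<in> S \<Longrightarrow> v \<in> lists X \<Longrightarrow> r s v = act s v"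
    and "w \<in> lists S" "v \<in> lists X"
  shows "foldl (\<lambda>v s. r s v) v w = acts w v"
  using assms(2,3) by (induction w arbitrary: v rule: lists.induct) (simp_all add: assms(1) act_in)

theorem theorem1p1:
  shows "\<exists>p :: recf. \<forall>A :: (nat, nat) automaton. bounded_automaton A \<longrightarrow>
    recf_eval p (automaton_input A) (if finite (carrier (automaton_group A)) then 1 else 0)"
proof -
  define xs :: "nat list \<Rightarrow> nat list" where "xs e = dec (e ! 0)" for e
  define ss :: "nat list \<Rightarrow> nat list" where "ss e = dec (e ! 1)" for e
  define tr :: "nat list \<Rightarrow> ((nat \<times> nat) \<times> (nat \<times> nat)) list" where "tr e = dec (e ! 2)" for e
  \<comment> \<open>\<open>pb\<close>, \<open>cb\<close>, \<open>wb\<close> and \<open>lb\<close>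
    recompute \<open>M\<close>, the number of codes, \<open>word_bound\<close> and
    \<open>level_bound\<close> from the input, with \<open>d\<close> and \<open>m\<close> as list
    lengths.\<close>
  define pb where "pb e = length (ss e) * length (xs e) ^ (2 * length (ss e) + 1)" for e
  define cb :: "nat list \<Rightarrow> nat" where
    "cb e = 2 ^ (pb e * length (ss e)) * 2 ^ (2 * pb e * (2 * pb e))" for e
  define wb where "wb e = (2 * pb e + 1) * (2 * pb e * length (xs e) + 1) ^ (cb e * (2 * pb e))" for e
  define lb where "lb e = cb e * 2 ^ (2 * pb e * Suc (Suc (wb e) * Suc (length (ss e)) ^ wb e))" for e
  define P where "P e \<longleftrightarrow> (\<forall>v\<in>set (words (xs e) (lb e)). \<forall>w\<in>set (words (ss e) (Suc (wb e))).
    \<exists>w'\<in>set (words (ss e) (wb e)).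
      foldl (\<lambda>v s. run (tr e) s v) v w = foldl (\<lambda>v s. run (tr e) s v) v w')" for e
  note arith = computable_add computable_mult computable_power computable_Suc computable_length
    computable_const
  have inputs: "computable 3 xs" "computable 3 ss" "computable 3 tr"
    unfolding xs_def ss_def tr_def by (intro computable_dec computable_nth; simp)+
  have pb: "computable 3 pb" unfolding pb_def by (intro arith inputs)
  have cb: "computable 3 cb" unfolding cb_def by (intro arith inputs pb)
  have wb: "computable 3 wb" unfolding wb_def by (intro arith inputs pb cb)
  have lb: "computable 3 lb" unfolding lb_def by (intro arith inputs pb cb wb)
  have "computable_pred 3 P"
    unfolding P_def by (intro computable_pred_shortening inputs lb wb)
  \<comment> \<open>The program is fixed before any automaton; boundedness is used only to interpret
    the value of \<open>P\<close>.\<close>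
  then obtain p where p: "\<And>e. length e = 3 \<Longrightarrow> recf_eval p e (if P e then 1 else 0)"
    unfolding computable_pred_def computable_def enc_nat_def by blast
  have "P (automaton_input A) \<longleftrightarrow> finite (carrier (automaton_group A))"
    if "bounded_automaton A" for A
  proof -
    interpret bounded_aut A by (unfold_locales) (rule that)
    let ?e = "automaton_input A"
    have input: "xs ?e = sorted_list_of_set X" "ss ?e = sorted_list_of_set S"
      "tr ?e = transitions A"
      by (simp_all add: automaton_input_eq xs_def ss_def tr_def)
    then have len: "length (xs ?e) = d" "length (ss ?e) = m" by (simp_all add: d_def m_def)
    have B: "wb ?e = word_bound"
      unfolding wb_def cb_def pb_def len word_bound_def D_def K_def M_def ..
    have N: "lb ?e = level_bound"
      unfolding lb_def B unfolding cb_def pb_def len level_bound_def L_def shortening_bound_def M_def ..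
    have run: "run (tr ?e) s v = act s v" if "s \<in> S" "v \<in> lists X" for s v
      using run_eq_action[OF lookup_transitions] automaton_simps(1) that by (simp add: input)
    have "P ?e \<longleftrightarrow> (\<forall>v\<in>{v \<in> lists X. length v \<le> level_bound}.
      \<forall>w\<in>{w \<in> lists S. length w \<le> Suc word_bound}.
      \<exists>w'\<in>{w \<in> lists S. length w \<le> word_bound}. acts w v = acts w' v)"
      unfolding P_def set_words B N input set_sorted_list_of_set[OF finite_S]
        set_sorted_list_of_set[OF finite_X]
      using foldl_run[OF run] by (simp add: input)
    also have "\<dots> \<longleftrightarrow> shortening level_bound word_bound"
      unfolding shortening_def by blast
    finally show ?thesis using finite_automaton_group_iff by simp
  qed
  moreover have "length (automaton_input A) = 3" for A by (simp add: automaton_input_eq)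
  ultimately show ?thesis using p by metis
qed

end
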